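(* Let $q\in\mathbb{C}$ with $0<|q|<1$. (1) If $w\in\mathbb{C}\setminus\{0\}$ and $w\neq q^{\ell}$ for all $\ell\in\mathbb{Z}$, then $$g_{2,1}(w;q^{-1})=-w^{-2}\psi_3(w;q)-w^{-1}+S_4(w;q)$$ and $$g_{2,2}(w;q^{-1})=\psi_3(w^{-1};q)+S_1(-w^{-1};q).$$ (2) If $w\in\mathbb{C}$ with $|w|>1$ and $w\neq q^{\ell}$ for all $\ell\in\mathbb{N}$, then $$g_{2,3}(w;q^{-1})=\psi_3(w^{-1};q).$$
   Context: Notation: for any base $p\in\mathbb{C}\setminus\{0\}$, $(a;p)_n:=\prod_{j=0}^{n-1}(1-ap^j)$ for $n\in\mathbb{N}_0$, and $(a_1,\dots,a_r;p)_n:=(a_1;p)_n\cdots(a_r;p)_n$; for $|p|<1$ also $(a;p)_\infty:=\prod_{j\ge0}(1-ap^j)$ and similarly for several arguments. When the base is omitted it is $q$. $\mathbb{N}=\{1,2,\dots\}$, and $\left(\frac{\cdot}{\cdot}\right)$ is the Kronecker symbol. For a base $p$ with $|p|\neq1$, define by the following series (for $p=q^{-1}$ one uses the same series, with every occurrence of the base replaced by $q^{-1}$): $$g_{2,1}(w;p):=\sum_{n\ge0}\frac{(-p;p)_n\,p^{\frac{n(n+1)}{2}}}{(w,w^{-1}p;p)_{n+1}},$$ $$O_2(w;p):=\sum_{n\ge0}\frac{(-1;p)_n\,p^{\frac{n(n+1)}2}}{(wp,w^{-1}p;p)_n},\qquad g_{2,2}(w;p):=\frac{1+w}{2w(1-w)}O_2(w;p)-\frac1{2w},$$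 $$g_{2,3}(w;p):=-\frac{1+w}{2w^2}\sum_{n\ge0}\frac{(-wp;p)_n}{(wp;p)_n}w^{-n}-\frac1{2w}.$$ For $|q|<1$ define $$\psi_1(w;q):=-w-w^2\sum_{n\ge0}\left(\frac{12}{n}\right)w^{\frac{n-1}{2}}q^{\frac{n^2-1}{24}}$$ (the Kronecker symbol vanishes unless $\gcd(n,12)=1$, so only integral exponents occur), $$\psi_3(w;q):=\sum_{n\ge0}(-1)^{n+1}w^{2n+1}q^{n^2},\qquad \psi_4(w;q):=\sum_{n\ge1}w^{3n-2}q^{\frac{3n^2-n}2}\left(1-wq^n\right).$$ For $w\neq0$, $w\neq-q^{\ell}$ $(\ell\in\mathbb{Z})$ define $$S_1(w;q):=\frac{(-q)_\infty}{(-w^{-1},-wq)_\infty}\left(w^{-1}\psi_1(w;q)+1\right),$$ and for $w\neq0$, $w\neq q^{\ell}$ $(\ell\in\mathbb{Z})$ define $$S_4(w;q):=\frac{(-q)_\infty}{(wq,w^{-1})_\infty}\,\psi_4(w;q).$$ *)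

theory Defs
  imports "HOL-Analysis.Analysis" "HOL-Number_Theory.Number_Theory"
begin

text \<open>The base \<open>p\<close> of the finite symbol is arbitrary; the infinite symbol is
  meant for \<open>norm p < 1\<close>. Symbols with several upper arguments are
  written out as products.\<close>

definition qpoch :: "complex \<Rightarrow> complex \<Rightarrow> nat \<Rightarrow> complex" where
  "qpoch a p n = (\<Prod>j<n. 1 - a * p ^ j)"

definition qpoch_inf :: "complex \<Rightarrow> complex \<Rightarrow> complex" where
  "qpoch_inf a p = (\<Prod>j. 1 - a * p ^ j)"

definition kronecker_prime :: "int \<Rightarrow> int \<Rightarrow> int" where
  "kronecker_prime a p =
     (if p = 2 then (if even a then 0 else if a mod 8 \<in> {1, 7} then 1 else -1)
      else Legendre a p)"

text \<open>For \<open>n < 0\<close> the sign is the unit factor \<open>(a/-1)\<close>, and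
  \<^const>\<open>prime_factors\<close> consists of the positive prime divisors.\<close>

definition kronecker :: "int \<Rightarrow> int \<Rightarrow> int" where
  "kronecker a n =
     (if n = 0 then (if \<bar>a\<bar> = 1 then 1 else 0)
      else (if n < 0 \<and> a < 0 then -1 else 1) *
           (\<Prod>p\<in>prime_factors n. kronecker_prime a p ^ multiplicity p n))"

definition g21 :: "complex \<Rightarrow> complex \<Rightarrow> complex" where
  "g21 w p = (\<Sum>n. qpoch (- p) p n * p ^ (n * (n + 1) div 2)
                   / (qpoch w p (n + 1) * qpoch (inverse w * p) p (n + 1)))"

definition O2 :: "complex \<Rightarrow> complex \<Rightarrow> complex" where
  "O2 w p = (\<Sum>n. qpoch (-1) p n * p ^ (n * (n + 1) div 2)
                  / (qpoch (w * p) p n * qpoch (inverse w * p) p n))"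

definition g22 :: "complex \<Rightarrow> complex \<Rightarrow> complex" where
  "g22 w p = (1 + w) / (2 * w * (1 - w)) * O2 w p - 1 / (2 * w)"

definition g23 :: "complex \<Rightarrow> complex \<Rightarrow> complex" where
  "g23 w p = - ((1 + w) / (2 * w\<^sup>2)) *
                (\<Sum>n. qpoch (- w * p) p n / qpoch (w * p) p n * w powi (- int n))
             - 1 / (2 * w)"

text \<open>In \<open>\<psi>\<^sub>1\<close> the symbol \<open>(12/n)\<close> vanishes unless \<open>n\<close> is coprime to 12, and for such
  \<open>n\<close> both divisions in the exponents are exact, so the values of the truncated exponents
  at the remaining \<open>n\<close> (including \<open>n = 0\<close>) are irrelevant.\<close>

definition \<psi>1 :: "complex \<Rightarrow> complex \<Rightarrow> complex" where
  "\<psi>1 w q = - w - w\<^sup>2 * (\<Sum>n. of_int (kronecker 12 (int n)) * w ^ ((n - 1) div 2)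
                                * q ^ ((n\<^sup>2 - 1) div 24))"

definition \<psi>3 :: "complex \<Rightarrow> complex \<Rightarrow> complex" where
  "\<psi>3 w q = (\<Sum>n. (-1) ^ (n + 1) * w ^ (2 * n + 1) * q ^ (n\<^sup>2))"

text \<open>The series for \<open>\<psi>\<^sub>4\<close> runs over \<open>n \<ge> 1\<close>, hence the shift by \<^const>\<open>Suc\<close>.\<close>

definition \<psi>4 :: "complex \<Rightarrow> complex \<Rightarrow> complex" where
  "\<psi>4 w q = (\<Sum>k. let n = Suc k in
                w ^ (3 * n - 2) * q ^ ((3 * n\<^sup>2 - n) div 2) * (1 - w * q ^ n))"

definition S1 :: "complex \<Rightarrow> complex \<Rightarrow> complex" where
  "S1 w q = qpoch_inf (- q) q / (qpoch_inf (- inverse w) q * qpoch_inf (- w * q) q)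
              * (inverse w * \<psi>1 w q + 1)"

definition S4 :: "complex \<Rightarrow> complex \<Rightarrow> complex" where
  "S4 w q = qpoch_inf (- q) q / (qpoch_inf (w * q) q * qpoch_inf (inverse w) q) * \<psi>4 w q"

end

theory Submission
  imports Defs
begin

text \<open>Replacing the base by its inverse turns the three series into convergent series in \<open>q\<close>.
  Each of them, as a function \<open>f(w)\<close>, satisfies a first-order functional equation
  \<open>f(w) = r(w) + c(w) f(wq)\<close> with \<open>c(w)\<close> a constant times \<open>w\<^sup>2\<close>, because
  \<open>t\<^sub>n(w) - c(w) t\<^sub>n(wq)\<close> telescopes for an explicit \<open>U\<^sub>n\<close>; the limit of \<open>U\<^sub>n\<close> produces the
  infinite products. As \<open>f(wq\<^sup>N)\<close> stays bounded and the product of the first \<open>N\<close> coefficients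
  decays like \<open>q\<close> to the power \<open>N\<^sup>2\<close>, iterating the equation expands \<open>f\<close> into the partial theta series on
  the right-hand side.\<close>

subsection \<open>The Kronecker symbol of 12\<close>

text \<open>Both theta functions on a right-hand side come out of one iteration. The boundary value
  U_0 is rational in w and sums to \<psi>3; the limit of U_n carries a quotient by the theta product
  (wq, 1/w)_inf. That product is quasi-periodic: its reciprocal at w q^k supplies (-w)^k
  q^(k(k+1)/2), and with the k-fold product of the coefficients this yields the cubes w^(3k) in
  \<psi>4 and \<psi>1. For \<open>g23\<close> the limit of U_n is 0, so only \<psi>3 survives. The
  obstacle is boundedness along the orbit: w q^N tends to 0 while 1/(w q^N) is unbounded, so the
  denominators need lower bounds uniform in both N and n. For \<open>g22\<close> and
  \<open>g23\<close> the iteration runs in x = 1/w, which turns |w| > 1 into |x| < 1, a condition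
  preserved by multiplication by q. The Kronecker symbol occurs only in \<psi>1; reducing it to a
  character mod 12 exposes the signs on the classes 1 and 5 mod 6.\<close>

definition chi12 :: "nat \<Rightarrow> int" where
  "chi12 n = (if n mod 12 \<in> {1, 11} then 1 else if n mod 12 \<in> {5, 7} then -1 else 0)"

lemma chi12_mult: "chi12 (m * n) = chi12 m * chi12 n"
proof -
  have "\<forall>a\<in>{..<12::nat}. \<forall>b\<in>{..<12}. chi12 (a * b) = chi12 a * chi12 b"
    by (simp add: lessThan_nat_numeral lessThan_Suc chi12_def)
  moreover have "chi12 (k mod 12) = chi12 k" for k by (simp add: chi12_def)
  moreover have "chi12 (m * n) = chi12 ((m mod 12) * (n mod 12))"
    by (simp add: chi12_def mod_mult_eq)
  ultimately show ?thesis by (metis lessThan_iff mod_less_divisor zero_less_numeral)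
qed

lemma chi12_power: "chi12 (m ^ k) = chi12 m ^ k"
  by (induction k) (simp_all add: chi12_mult, simp add: chi12_def)

lemma chi12_prod: "chi12 (prod f A) = (\<Prod>x\<in>A. chi12 (f x))"
  by (induction A rule: infinite_finite_induct) (simp_all add: chi12_mult, simp_all add: chi12_def)

text \<open>The factor 4 is a square: by Fermat its power to (p-1)/2 is 1, so Euler's criterion
  cannot tell 12 from 3 modulo p. Congruent values are equal because they differ by at most 2 <
  p.\<close>

lemma Legendre_12_eq_Legendre_3:
  fixes p :: nat
  assumes "prime p" "2 < p"
  shows "Legendre 12 p = Legendre 3 p"
proof -
  let ?k = "(p - 1) div 2"
  have odd: "odd p" using assms by (simp add: prime_odd_nat)
  have "[int 2 ^ (p - 1) = 1] (mod int p)"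
    proof -
    have "\<not> p dvd 2" using assms(2) by (auto dest: dvd_imp_le)
    then have "[2 ^ (p - 1) = 1] (mod p)" by (rule fermat_theorem[OF assms(1)])
    then show ?thesis using cong_int_iff[of "2^(p-1)" 1 p] by (simp del: One_nat_def)
  qed
  moreover have "(4::int) ^ ?k = 2 ^ (p - 1)"
    using odd power_mult[of "2::int" 2 ?k] by simp
  ultimately have "[(4::int) ^ ?k = 1] (mod int p)" by simp
  then have "[3 ^ ?k * (4::int) ^ ?k = 3 ^ ?k * 1] (mod int p)" by (rule cong_mult[OF cong_refl])
  then have "[(12::int) ^ ?k = 3 ^ ?k] (mod int p)" by (simp flip: power_mult_distrib)
  then have "[Legendre 12 p = Legendre 3 p] (mod int p)"
    using euler_criterion[OF assms] 
    by (metis cong_sym cong_trans)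
  then have "int p dvd Legendre 12 p - Legendre 3 p" by (simp add: cong_iff_dvd_diff)
  moreover have "\<bar>Legendre 12 p - Legendre 3 p\<bar> < int p"
    using assms by (auto simp: Legendre_def)
  ultimately show ?thesis using zdvd_not_zless
    by (metis abs_of_nonneg dvd_abs_iff abs_ge_zero abs_eq_0 eq_iff_diff_eq_0 linorder_neqE_linordered_idom not_less)
qed

lemma Legendre_mod_3: "Legendre (int p) 3 = (if p mod 3 = 0 then 0 else if p mod 3 = 1 then 1 else -1)"
proof -
  have sq: "(y::int)\<^sup>2 mod 3 = 0 \<or> y\<^sup>2 mod 3 = 1" for y
  proof -
    have "y\<^sup>2 mod 3 = (y mod 3)\<^sup>2 mod 3" by (simp add: power_mod)
    moreover have "y mod 3 \<in> {0,1,2}" by auto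
    ultimately show ?thesis by auto
  qed
  have 1: "QuadRes 3 (int p)" if "p mod 3 = 1"
  proof -
    have "int p mod 3 = 1" using that by presburger
    then show ?thesis unfolding QuadRes_def cong_def by (intro exI[of _ 1]) simp
  qed
  have 2: "\<not> QuadRes 3 (int p)" if "p mod 3 = 2"
  proof
    assume "QuadRes 3 (int p)"
    then obtain y :: int where "y\<^sup>2 mod 3 = int p mod 3" by (auto simp: QuadRes_def cong_def)
    moreover have "int p mod 3 = 2" using that by presburger
    ultimately show False using sq[of y] by simp
  qed
  have "p mod 3 = 0 \<or> p mod 3 = 1 \<or> p mod 3 = 2" by presburger
  moreover have "[int p = 0] (mod 3) \<longleftrightarrow> p mod 3 = 0" unfolding cong_def by presburger
  ultimately show ?thesis using 1 2 by (auto simp: Legendre_def)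
qed

text \<open>For p > 3, reciprocity trades (3/p) for (p/3) and a sign; the former depends on p mod 3
  and the latter on p mod 4, so p mod 12 decides. The primes 2 and 3 divide 12 and give 0.\<close>

lemma kronecker_prime_12:
  fixes p :: nat
  assumes "prime p"
  shows "kronecker_prime 12 p = chi12 p"
proof -
  consider "p = 2" | "p = 3" | "p > 3" using prime_ge_2_nat[OF assms] by linarith
  then show ?thesis
  proof cases
    case 3
    have odd: "odd p" using assms 3 by (simp add: prime_odd_nat)
    have n3: "\<not> 3 dvd p" using assms 3 by (metis prime_nat_iff less_irrefl numeral_eq_one_iff semiring_norm(86))
    have qr: "Legendre 3 p * Legendre p 3 = (-1) ^ ((p - 1) div 2)"
      using Quadratic_Reciprocity[of 3 p] assms 3 by simp
    define k where "k = p div 12"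
    have p: "p = 12 * k + p mod 12" by (simp add: k_def)
    have "p mod 12 \<in> {..<12}" "p mod 12 mod 2 \<noteq> 0" "p mod 12 mod 3 \<noteq> 0"
      using odd n3 by (simp_all add: mod_mod_cancel odd_iff_mod_2_eq_one dvd_eq_mod_eq_0)
    then have "p mod 12 = 1 \<or> p mod 12 = 5 \<or> p mod 12 = 7 \<or> p mod 12 = 11"
      by (simp add: lessThan_nat_numeral lessThan_Suc) (elim disjE, simp_all)
    then consider "p = 12 * k + 1" | "p = 12 * k + 5" | "p = 12 * k + 7" | "p = 12 * k + 11"
      using p by metis
    then have "Legendre 3 p = chi12 p"
    proof cases
      case 1
      then have "(p - 1) div 2 = 6 * k" "p mod 12 = 1" by simp_all
      moreover have "p = 3 * (4 * k) + 1" using 1 by simp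
      then have "p mod 3 = 1" by (simp only: mod_mult_self4) simp
      ultimately show ?thesis using qr by (simp add: Legendre_mod_3 chi12_def power_add power_mult)
    next
      case 2
      then have "(p - 1) div 2 = 6 * k + 2" "p mod 12 = 5" by simp_all
      moreover have "p = 3 * (4 * k + 1) + 2" using 2 by simp
      then have "p mod 3 = 2" by (simp only: mod_mult_self4) simp
      ultimately show ?thesis using qr by (simp add: Legendre_mod_3 chi12_def power_add power_mult)
    next
      case 3
      then have "(p - 1) div 2 = 6 * k + 3" "p mod 12 = 7" by simp_all
      moreover have "p = 3 * (4 * k + 2) + 1" using 3 by simp
      then have "p mod 3 = 1" by (simp only: mod_mult_self4) simp
      ultimately show ?thesis using qr by (simp add: Legendre_mod_3 chi12_def power_add power_mult)
    next
      case 4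
      then have "(p - 1) div 2 = 6 * k + 5" "p mod 12 = 11" by simp_all
      moreover have "p = 3 * (4 * k + 3) + 2" using 4 by simp
      then have "p mod 3 = 2" by (simp only: mod_mult_self4) simp
      ultimately show ?thesis using qr by (simp add: Legendre_mod_3 chi12_def power_add power_mult)
    qed
    then show ?thesis using 3 assms by (simp add: kronecker_prime_def Legendre_12_eq_Legendre_3)
  qed (simp_all add: kronecker_prime_def chi12_def Legendre_def cong_def)
qed

lemma multiplicity_int_of_nat: "multiplicity (int p) (int n) = multiplicity p n"
  by (simp add: multiplicity_def flip: of_nat_power)

text \<open>Both sides are completely multiplicative, so agreement at primes suffices; the rest
  transports prime factors between \<open>int\<close> and \<open>nat\<close>.\<close>

lemma kronecker_12: "kronecker 12 (int n) = chi12 n"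
proof (cases "n = 0")
  case True
  then show ?thesis by (simp add: kronecker_def chi12_def)
next
  case False
  have "kronecker 12 (int n) = (\<Prod>p\<in>prime_factors (int n). kronecker_prime 12 p ^ multiplicity p (int n))"
    using False by (simp add: kronecker_def)
  also have "prime_factors (int n) = int ` prime_factors n"
  proof (intro equalityI subsetI)
    fix x assume "x \<in> prime_factors (int n)"
    then have x: "prime x" "x dvd int n" by (auto simp: in_prime_factors_iff)
    then obtain m where "x = int m" using prime_ge_0_int zero_le_imp_eq_int by blast
    with x False show "x \<in> int ` prime_factors n" by (auto simp: in_prime_factors_iff)
  qed (use False in \<open>auto simp: in_prime_factors_iff\<close>)
  also have "(\<Prod>p\<in>int ` prime_factors n. kronecker_prime 12 p ^ multiplicity p (int n))
           = (\<Prod>p\<in>prime_factors n. kronecker_prime 12 (int p) ^ multiplicity (int p) (int n))"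
    by (subst prod.reindex) (auto simp: o_def)
  also have "\<dots> = (\<Prod>p\<in>prime_factors n. chi12 (p ^ multiplicity p n))"
    by (intro prod.cong)
       (auto simp: chi12_power kronecker_prime_12 in_prime_factors_iff multiplicity_int_of_nat)
  also have "\<dots> = chi12 n"
    using False prime_factorization_nat[of n] by (simp flip: chi12_prod)
  finally show ?thesis .
qed

text \<open>Within a class mod 6 the character simply alternates; this sign later cancels the one
  from the negative argument of \<psi>1.\<close>

lemma chi12_1_mod_6: "chi12 (6 * m + 1) = (- 1) ^ m"
proof (cases "even m")
  case True
  then obtain j where "m = 2 * j" by blast
  then show ?thesis by (simp add: chi12_def mod_Suc)
next
  case False
  then obtain j where "m = 2 * j + 1" by (rule oddE)
  then have "6 * m + 1 = 7 + 12 * j" "odd m" by simp_all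
  then show ?thesis unfolding chi12_def by (simp only: mod_mult_self2) simp
qed

lemma chi12_5_mod_6: "chi12 (6 * m + 5) = - ((- 1) ^ m)"
proof (cases "even m")
  case True
  then obtain j where "m = 2 * j" by blast
  then have "6 * m + 5 = 5 + 12 * j" "even m" by simp_all
  then show ?thesis unfolding chi12_def by (simp only: mod_mult_self2) simp
next
  case False
  then obtain j where "m = 2 * j + 1" by (rule oddE)
  then have "6 * m + 5 = 11 + 12 * j" "odd m" by simp_all
  then show ?thesis unfolding chi12_def by (simp only: mod_mult_self2) simp
qed

subsection \<open>Shifted factorials and iteration\<close>

text \<open>Summability is asked of the scaled series because the scalar may vanish: at x = -1 the
  prefactor 1 + x of \<open>term22\<close> is 0 and cannot be divided out.\<close>

lemma suminf_mult_left:
  fixes f :: "nat \<Rightarrow> complex"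
  assumes "summable (\<lambda>n. c * f n)"
  shows "(\<Sum>n. c * f n) = c * suminf f"
  using assms by (cases "c = 0") (simp_all add: suminf_mult)

lemma qpoch_0 [simp]: "qpoch a p 0 = 1"
  by (simp add: qpoch_def)

lemma qpoch_Suc: "qpoch a p (Suc n) = qpoch a p n * (1 - a * p ^ n)"
  by (simp add: qpoch_def)

lemma qpoch_Suc_shift: "qpoch a p (Suc n) = (1 - a) * qpoch (a * p) p n"
  unfolding qpoch_def by (subst prod.lessThan_Suc_shift) (simp add: mult_ac)

definition tri :: "nat \<Rightarrow> nat" where
  "tri n = n * (n + 1) div 2"

lemma tri_0 [simp]: "tri 0 = 0"
  by (simp add: tri_def)

lemma tri_Suc: "tri (Suc n) = tri n + Suc n"
  by (simp add: tri_def)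

lemma double_tri: "2 * tri n = n * n + n"
  by (simp add: tri_def)

text \<open>Factorwise, 1 - a/q^j = (-a) q^(-j) (1 - q^j/a). The exponents 0, ..., n-1 add up to
  \<open>tri n\<close> - n, written as two separate powers to avoid subtraction.\<close>

lemma qpoch_inverse_base:
  assumes "a \<noteq> 0" "q \<noteq> 0"
  shows "qpoch a (inverse q) n =
           (- a) ^ n * inverse q ^ tri n * q ^ n * qpoch (inverse a) q n"
proof (induction n)
  case (Suc n)
  have "1 - a * inverse q ^ n = (- a) * inverse q ^ Suc n * q * (1 - inverse a * q ^ n)"
    using assms by (simp add: field_simps)
  then show ?case by (simp only: tri_Suc qpoch_Suc Suc.IH power_add power_Suc mult_ac)
qed simp

text \<open>Unrolling n times leaves exactly the remainder (c_0 ... c_{n-1}) h_n, a null sequence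
  times a bounded one. Convergence of the series is thus a conclusion.\<close>

lemma tendsto_iterate_sums:
  fixes h r c :: "nat \<Rightarrow> complex"
  assumes step: "\<And>k. h k = r k + c k * h (Suc k)"
    and "Bseq h" and "(\<lambda>n. \<Prod>j<n. c j) \<longlonglongrightarrow> 0"
  shows "(\<lambda>k. (\<Prod>j<k. c j) * r k) sums h 0"
proof -
  have *: "(\<Sum>k<n. (\<Prod>j<k. c j) * r k) = h 0 - (\<Prod>j<n. c j) * h n" for n
  proof (induction n)
    case (Suc n)
    then show ?case using step[of n] by (simp add: algebra_simps)
  qed simp
  have "(\<lambda>n. (\<Prod>j<n. c j) * h n) \<longlonglongrightarrow> 0"
    using bounded_bilinear.Zfun_prod_Bfun[OF bounded_bilinear_mult _ assms(2)] assms(3)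
    by (simp add: tendsto_Zfun_iff)
  then have "(\<lambda>n. h 0 - (\<Prod>j<n. c j) * h n) \<longlonglongrightarrow> h 0 - 0" by (intro tendsto_intros)
  then show ?thesis unfolding sums_def * by simp
qed

section \<open>Bounds for q-factorials, uniform in length and shift\<close>

text \<open>Only the shortfall of |a_k| below 1 can make a product small, so factors are capped at
  1. The capped partial products decrease to a positive limit, which bounds every finite product
  from below, however large the uncapped factors are.\<close>

lemma norm_prod_bounded_below:
  fixes a :: "nat \<Rightarrow> complex"
  assumes nz: "\<And>k. a k \<noteq> 0" and sm: "summable (\<lambda>k. max 0 (1 - norm (a k)))"
  obtains \<eta> where "\<eta> > 0" "\<And>A. finite A \<Longrightarrow> \<eta> \<le> norm (\<Prod>k\<in>A. a k)"
proof -
  define b where "b k = min 1 (norm (a k))" for k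
  have b: "0 < b k" "b k \<le> 1" "b k \<le> norm (a k)" for k using nz by (auto simp: b_def)
  have "norm (b k - 1) = max 0 (1 - norm (a k))" for k by (auto simp: b_def min_def max_def)
  then have "convergent_prod b"
    using sm by (intro abs_convergent_prod_imp_convergent_prod summable_imp_abs_convergent_prod) simp
  then have L: "(\<lambda>n. \<Prod>i\<le>n. b i) \<longlonglongrightarrow> prodinf b" "prodinf b \<noteq> 0"
    using b(1) by (simp add: convergent_prod_LIMSEQ, metis prodinf_nonzero less_irrefl)
  have "decseq (\<lambda>n. \<Prod>i\<le>n. b i)"
    by (intro decseq_SucI) (use b in \<open>auto intro!: mult_left_le prod_nonneg simp: less_imp_le\<close>)
  then have ge: "prodinf b \<le> (\<Prod>i\<le>n. b i)" for n using L(1) decseq_ge by blast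
  have "0 \<le> prodinf b"
    using L(1) b(1) by (intro LIMSEQ_le_const[OF L(1)]) (auto intro!: prod_nonneg simp: less_imp_le)
  then have "prodinf b > 0" using L(2) by simp
  moreover have "prodinf b \<le> norm (\<Prod>k\<in>A. a k)" if A: "finite A" for A
  proof -
    obtain n where n: "A \<subseteq> {..n}"
      using A unfolding finite_nat_iff_bounded_le by blast
    have "prodinf b \<le> (\<Prod>i\<le>n. b i)" by (rule ge)
    \<comment> \<open>The omitted factors are at most 1, so passing to a subset does not decrease
      the product.\<close>
    also have "\<dots> \<le> (\<Prod>i\<in>A. b i)"
      unfolding prod.subset_diff[OF n finite_atMost, of b] using b
      by (intro mult_left_le_one_le prod_le_1 prod_nonneg) (auto simp: less_imp_le)
    also have "\<dots> \<le> (\<Prod>i\<in>A. norm (a i))" using b by (intro prod_mono) (auto simp: less_imp_le)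
    finally show ?thesis by (simp add: prod_norm)
  qed
  ultimately show ?thesis using that by blast
qed

locale nome =
  fixes q :: complex
  assumes q0: "0 < norm q" and q1: "norm q < 1"
begin

text \<open>The hypothesis is e(n) >= n(n-1)/2 without division. It gives e(n) >= K n once n >= 2K +
  1, and K is chosen so that |a| |q|^K < 1/2.\<close>

lemma summable_quadratic:
  assumes "\<And>n. n * n \<le> 2 * e n + n"
  shows "summable (\<lambda>n. a ^ n * q ^ e n)"
proof -
  have "(\<lambda>n. norm a * norm q ^ n) \<longlonglongrightarrow> norm a * 0"
    using q1 by (intro tendsto_intros LIMSEQ_power_zero) auto
  then have "eventually (\<lambda>n. norm a * norm q ^ n < 1/2) sequentially"
    by (rule order_tendstoD) simp
  then obtain K where K: "norm a * norm q ^ K < 1/2"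
    by (meson eventually_sequentially order_refl)
  show ?thesis
  proof (rule summable_comparison_test'[where g = "\<lambda>n. (1/2) ^ n" and N = "2 * K + 1"])
    fix n assume n: "n \<ge> 2 * K + 1"
    have "(2 * K + 1) * n \<le> n * n" using n by (rule mult_le_mono1)
    also have "\<dots> \<le> 2 * e n + n" by (rule assms)
    finally have "K * n \<le> e n" by simp
    then have "norm (a ^ n * q ^ e n) \<le> norm a ^ n * norm q ^ (K * n)"
      using q1 by (auto simp: norm_mult norm_power intro!: mult_left_mono power_decreasing)
    also have "\<dots> = (norm a * norm q ^ K) ^ n"
      by (simp add: power_mult power_mult_distrib)
    also have "\<dots> \<le> (1/2) ^ n" using K by (intro power_mono) auto
    finally show "norm (a ^ n * q ^ e n) \<le> (1/2) ^ n" .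
  qed simp
qed

lemma summable_mult_power: "summable (\<lambda>k. norm (a * q ^ k))"
  using q1 by (simp add: norm_mult norm_power summable_mult)

lemma convergent_prod_qpoch: "convergent_prod (\<lambda>j. 1 - a * q ^ j)"
  using summable_mult_power[of a]
  by (intro abs_convergent_prod_imp_convergent_prod summable_imp_abs_convergent_prod) simp

lemma qpoch_tendsto: "(\<lambda>n. qpoch a q n) \<longlonglongrightarrow> qpoch_inf a q"
proof -
  have "(\<lambda>n. qpoch a q (Suc n)) \<longlonglongrightarrow> qpoch_inf a q"
    using convergent_prod_LIMSEQ[OF convergent_prod_qpoch[of a]]
    by (simp add: qpoch_def qpoch_inf_def lessThan_Suc_atMost)
  then show ?thesis by (simp only: filterlim_sequentially_Suc)
qed

lemma qpoch_inf_nonzero: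
  assumes "\<And>j. 1 - a * q ^ j \<noteq> 0"
  shows "qpoch_inf a q \<noteq> 0"
  unfolding qpoch_inf_def using convergent_prod_qpoch assms by (rule prodinf_nonzero)

lemma qpoch_inf_shift: "qpoch_inf a q = (1 - a) * qpoch_inf (a * q) q"
proof (rule LIMSEQ_unique)
  show "(\<lambda>n. qpoch a q (Suc n)) \<longlonglongrightarrow> qpoch_inf a q"
    using qpoch_tendsto by (simp only: filterlim_sequentially_Suc)
  show "(\<lambda>n. qpoch a q (Suc n)) \<longlonglongrightarrow> (1 - a) * qpoch_inf (a * q) q"
    unfolding qpoch_Suc_shift by (intro tendsto_intros qpoch_tendsto)
qed

lemma norm_qpoch_le: "norm (qpoch a q n) \<le> exp (norm a / (1 - norm q))"
proof -
  have "norm (qpoch a q n) = (\<Prod>j<n. norm (1 - a * q ^ j))" by (simp add: qpoch_def prod_norm)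
  also have "\<dots> \<le> (\<Prod>j<n. exp (norm a * norm q ^ j))"
  proof (intro prod_mono conjI)
    fix j
    have "norm (1 - a * q ^ j) \<le> 1 + norm a * norm q ^ j"
      using norm_triangle_ineq4[of 1 "a * q ^ j"] by (simp add: norm_mult norm_power)
    also have "\<dots> \<le> exp (norm a * norm q ^ j)" by (rule exp_ge_add_one_self)
    finally show "norm (1 - a * q ^ j) \<le> exp (norm a * norm q ^ j)" .
  qed auto
  also have "\<dots> = exp (norm a * (\<Sum>j<n. norm q ^ j))"
    by (simp add: exp_sum sum_distrib_left)
  also have "(\<Sum>j<n. norm q ^ j) \<le> 1 / (1 - norm q)"
    using sum_le_suminf[of "\<lambda>j. norm q ^ j" "{..<n}"] q1 by (simp add: suminf_geometric)
  finally show ?thesis by (simp add: mult_left_mono)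
qed

text \<open>Every shifted factorial is a block of consecutive factors of one fixed convergent
  product, so a bound over all finite index sets is uniform in N and n.\<close>

lemma qpoch_bounded_below_up:
  assumes nz: "\<And>j. w * q ^ j \<noteq> 1"
  obtains \<eta> where "\<eta> > 0" "\<And>N n. \<eta> \<le> norm (qpoch (w * q ^ N) q n)"
proof -
  have nz1: "1 - w * q ^ k \<noteq> 0" for k using nz[of k] by simp
  have "summable (\<lambda>k. max 0 (1 - norm (1 - w * q ^ k)))"
  proof (rule summable_comparison_test'[OF summable_mult_power[of w]])
    fix k show "norm (max 0 (1 - norm (1 - w * q ^ k))) \<le> norm (w * q ^ k)"
      using norm_triangle_ineq2[of 1 "1 - w * q ^ k"] by auto
  qed
  from norm_prod_bounded_below[OF nz1 this] obtain \<eta> where \<eta>: "\<eta> > 0"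
      "\<And>A. finite A \<Longrightarrow> \<eta> \<le> norm (\<Prod>k\<in>A. 1 - w * q ^ k)"
    by blast
  have *: "qpoch (w * q ^ N) q n = (\<Prod>k\<in>{N..<N+n}. 1 - w * q ^ k)" for N n
    using prod.shift_bounds_nat_ivl[of "\<lambda>k. 1 - w * q ^ k" 0 N n]
    by (simp add: qpoch_def atLeast0LessThan power_add mult_ac add.commute)
  show ?thesis by (rule that[OF \<eta>(1)]) (use \<eta>(2) in \<open>simp add: *\<close>)
qed

text \<open>The j-th factor contains q^(j-N)/w. For j >= N these form a factorial of 1/w; for j < N
  they are 1 - 1/(w q^k) with k = N - j, which have norm at least 1 for all large k and hence no
  shortfall.\<close>

lemma qpoch_bounded_below_down:
  assumes "w \<noteq> 0" and nz: "\<And>l::int. w \<noteq> q powi l"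
  obtains \<eta> where "\<eta> > 0" "\<And>N n. \<eta> \<le> norm (qpoch (inverse (w * q ^ N)) q n)"
proof -
  have qn: "q \<noteq> 0" using q0 by auto
  have nz1: "inverse w * q ^ j \<noteq> 1" for j
    using nz[of "int j"] assms(1) by (auto simp: field_simps power_int_def)
  have nz2: "1 - inverse (w * q ^ j) \<noteq> 0" for j
    using nz[of "- int j"] assms(1) qn by (auto simp: field_simps power_int_minus)
  obtain \<eta>1 where \<eta>1: "\<eta>1 > 0" "\<And>N n. \<eta>1 \<le> norm (qpoch (inverse w * q ^ N) q n)"
    using qpoch_bounded_below_up[OF nz1] by blast
  have "(\<lambda>k. norm w * norm q ^ k) \<longlonglongrightarrow> norm w * 0"
    using q1 by (intro tendsto_intros LIMSEQ_power_zero) auto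
  then have "eventually (\<lambda>k. norm w * norm q ^ k < 1/2) sequentially"
    by (rule order_tendstoD) simp
  then have "eventually (\<lambda>k. max 0 (1 - norm (1 - inverse (w * q ^ k))) = 0) sequentially"
  proof eventually_elim
    case (elim k)
    have "norm w * norm q ^ k > 0" using assms(1) q0 by simp
    then have "2 \<le> inverse (norm w * norm q ^ k)"
      using elim by (simp add: field_simps)
    then have "2 \<le> norm (inverse (w * q ^ k))"
      by (simp add: norm_inverse norm_mult norm_power)
    then show ?case using norm_triangle_ineq2[of "inverse (w * q ^ k)" 1]
      by (simp add: norm_minus_commute)
  qed
  then have "summable (\<lambda>k. max 0 (1 - norm (1 - inverse (w * q ^ k))))"
    by (subst summable_cong) auto
  from norm_prod_bounded_below[OF nz2 this] obtain \<eta>2 where \<eta>2: "\<eta>2 > 0"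
      "\<And>A. finite A \<Longrightarrow> \<eta>2 \<le> norm (\<Prod>k\<in>A. 1 - inverse (w * q ^ k))"
    by blast
  have "\<eta>2 * \<eta>1 \<le> norm (qpoch (inverse (w * q ^ N)) q n)" for N n
  proof -
    let ?f = "\<lambda>j. 1 - inverse (w * q ^ N) * q ^ j" and ?m = "min N n"
    have "qpoch (inverse (w * q ^ N)) q n = (\<Prod>j<?m. ?f j) * (\<Prod>j\<in>{?m..<n}. ?f j)"
      using prod.atLeastLessThan_concat[of 0 ?m n ?f] by (simp add: qpoch_def atLeast0LessThan)
    also have "(\<Prod>j<?m. ?f j) = (\<Prod>k\<in>(\<lambda>j. N - j) ` {..<?m}. 1 - inverse (w * q ^ k))"
    proof (subst prod.reindex)
      show "inj_on (\<lambda>j. N - j) {..<?m}" by (auto simp: inj_on_def)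
      have "q ^ N = q ^ (N - j) * q ^ j" if "j < ?m" for j
        using that by (simp flip: power_add)
      then show "(\<Prod>j<?m. ?f j) = prod ((\<lambda>k. 1 - inverse (w * q ^ k)) \<circ> (\<lambda>j. N - j)) {..<?m}"
        using qn by (intro prod.cong) (auto simp: field_simps)
    qed
    also have "(\<Prod>j\<in>{?m..<n}. ?f j) = qpoch (inverse w) q (n - N)"
    proof (cases "N \<le> n")
      case True
      then have "(\<Prod>j\<in>{?m..<n}. ?f j) = (\<Prod>j\<in>{0+N..<(n-N)+N}. ?f j)" by simp
      also have "\<dots> = (\<Prod>j<n-N. ?f (j + N))"
        by (subst prod.shift_bounds_nat_ivl) (simp add: atLeast0LessThan)
      also have "\<dots> = qpoch (inverse w) q (n - N)"
        unfolding qpoch_def using qn by (intro prod.cong) (auto simp: power_add)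
      finally show ?thesis .
    qed simp
    finally show ?thesis
      using \<eta>1(1) \<eta>1(2)[of 0 "n - N"] \<eta>2(1) \<eta>2(2)[of "(\<lambda>j. N - j) ` {..<?m}"]
      by (auto simp: norm_mult intro!: mult_mono)
  qed
  then show ?thesis using that[of "\<eta>2 * \<eta>1"] \<eta>1(1) \<eta>2(1) by simp
qed

subsection \<open>Functional equations\<close>

lemma q_nonzero: "q \<noteq> 0"
  using q0 by auto

text \<open>Avoiding the whole lattice of powers of q is stable under w -> wq and w -> 1/w, so it
  passes to every iterate and to x = 1/w.\<close>

definition generic :: "complex \<Rightarrow> bool" where
  "generic w \<longleftrightarrow> w \<noteq> 0 \<and> (\<forall>l::int. w \<noteq> q powi l)"

lemma generic_mult_powi: "generic w \<Longrightarrow> generic (w * q powi k)"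
  unfolding generic_def
proof (intro conjI allI)
  fix l assume w: "w \<noteq> 0 \<and> (\<forall>l::int. w \<noteq> q powi l)"
  then have "w \<noteq> q powi (l - k)" by blast
  then show "w * q powi k \<noteq> q powi l"
    using q_nonzero by (auto simp: power_int_diff field_simps)
qed (use q_nonzero in auto)

lemma generic_mult_power: "generic w \<Longrightarrow> generic (w * q ^ k)"
  using generic_mult_powi[of w "int k"] by simp

lemma generic_mult_q: "generic w \<Longrightarrow> generic (w * q)"
  using generic_mult_power[of w 1] by simp

lemma generic_inverse: "generic w \<Longrightarrow> generic (inverse w)"
  unfolding generic_def
proof (intro conjI allI)
  fix l assume w: "w \<noteq> 0 \<and> (\<forall>l::int. w \<noteq> q powi l)"
  then have "w \<noteq> q powi (- l)" by blast
  then show "inverse w \<noteq> q powi l" by (metis inverse_inverse_eq power_int_minus)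
qed auto

lemma generic_nonzero: "generic w \<Longrightarrow> w \<noteq> 0"
  by (simp add: generic_def)

lemma generic_mult_power_ne_1: "generic w \<Longrightarrow> w * q ^ j \<noteq> 1"
  using generic_mult_power[of w j] unfolding generic_def by (metis power_int_0_right)

lemma generic_qpoch_nonzero: "generic w \<Longrightarrow> qpoch w q n \<noteq> 0"
  using generic_mult_power_ne_1[of w] by (simp add: qpoch_def)

lemma generic_qpoch_inf_nonzero: "generic w \<Longrightarrow> qpoch_inf w q \<noteq> 0"
  using generic_mult_power_ne_1[of w] by (intro qpoch_inf_nonzero) simp

text \<open>One geometric majorant shared by all N yields both inputs of the iteration: convergent
  series and a bounded orbit.\<close>

lemma geometric_family_bound:
  fixes t :: "nat \<Rightarrow> nat \<Rightarrow> complex"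
  assumes "\<And>N n. norm (t N n) \<le> B * \<rho> ^ n" "0 \<le> \<rho>" "\<rho> < 1"
  shows "summable (t N)" "Bseq (\<lambda>N. \<Sum>n. t N n)"
proof -
  have s: "summable (\<lambda>n. B * \<rho> ^ n)" using assms by (simp add: summable_mult)
  show "summable (t N)" by (rule summable_comparison_test'[OF s]) (rule assms)
  show "Bseq (\<lambda>N. \<Sum>n. t N n)"
    by (rule BseqI'[where K = "\<Sum>n. B * \<rho> ^ n"]) (rule norm_suminf_le[OF assms(1) s])
qed

text \<open>Up to the factor \<open>qpoch_inf q q\<close> this is the Jacobi theta product. It is
  the denominator of \<open>S4 w\<close> and also of \<open>S1 (- w)\<close>.\<close>

definition theta_denom :: "complex \<Rightarrow> complex" where
  "theta_denom w = qpoch_inf (w * q) q * qpoch_inf (inverse w) q"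

lemma theta_denom_nonzero: "generic w \<Longrightarrow> theta_denom w \<noteq> 0"
  by (simp add: theta_denom_def generic_qpoch_inf_nonzero generic_mult_q generic_inverse)

text \<open>Under w -> wq the first product loses 1 - wq and the second gains 1 - 1/(wq); their
  ratio is -wq.\<close>

lemma theta_denom_shift:
  assumes "generic w"
  shows "theta_denom w = - (w * q) * theta_denom (w * q)"
proof -
  have 1: "qpoch_inf (w * q) q = (1 - w * q) * qpoch_inf (w * q * q) q" by (rule qpoch_inf_shift)
  have 2: "qpoch_inf (inverse (w * q)) q = (1 - inverse (w * q)) * qpoch_inf (inverse w) q"
    using qpoch_inf_shift[of "inverse (w * q)"] q_nonzero by (simp add: mult.assoc)
  have "(1 - w * q) = - (w * q) * (1 - inverse (w * q))"
    using q_nonzero generic_nonzero[OF assms] by (simp add: field_simps)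
  then show ?thesis unfolding theta_denom_def 1 2 by simp
qed

lemma theta_denom_shift_power:
  assumes "generic w"
  shows "theta_denom w = (- w) ^ k * q ^ tri k * theta_denom (w * q ^ k)"
proof (induction k)
  case (Suc k)
  have "theta_denom (w * q ^ k) = - w * q ^ Suc k * theta_denom (w * q ^ Suc k)"
    using theta_denom_shift[OF generic_mult_power[OF assms, of k]] by (simp add: mult_ac)
  then show ?case by (subst Suc.IH) (simp only: tri_Suc power_add power_Suc mult_ac)
qed simp

text \<open>The summand of \<open>g21\<close> after inverting the base: all quadratic powers of q
  cancel and the geometric factor q^(n+1) remains.\<close>

definition term21 :: "complex \<Rightarrow> nat \<Rightarrow> complex" where
  "term21 w n = qpoch (- q) q n * q ^ Suc n
                  / (qpoch (inverse w) q (Suc n) * qpoch (w * q) q (Suc n))"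

text \<open>The argument \<open>x\<close> of \<open>term22\<close> and \<open>term23\<close> stands for \<open>1/w\<close>.\<close>

definition term22 :: "complex \<Rightarrow> nat \<Rightarrow> complex" where
  "term22 x n = - (1 + x) / (2 * (1 - x)) *
     (qpoch (- 1) q n * q ^ n / (qpoch (x * q) q n * qpoch (inverse x * q) q n))"

definition term23 :: "complex \<Rightarrow> nat \<Rightarrow> complex" where
  "term23 x n = (1 + x) * (qpoch (- x * q) q n / qpoch (x * q) q n * (- x) ^ n)"

lemma
  assumes "generic w"
  shows summable_term21: "summable (term21 w)"
    and Bseq_term21: "Bseq (\<lambda>N. \<Sum>n. term21 (w * q ^ N) n)"
proof -
  obtain \<eta> where \<eta>: "\<eta> > 0" "\<And>N n. \<eta> \<le> norm (qpoch (w * q * q ^ N) q n)"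
    using qpoch_bounded_below_up generic_mult_power_ne_1[OF generic_mult_q[OF assms]] by metis
  obtain \<epsilon> where \<epsilon>: "\<epsilon> > 0" "\<And>N n. \<epsilon> \<le> norm (qpoch (inverse (w * q ^ N)) q n)"
    using qpoch_bounded_below_down assms unfolding generic_def by metis
  define M where "M = exp (norm (- q) / (1 - norm q))"
  have bound: "norm (term21 (w * q ^ N) n) \<le> M / (\<epsilon> * \<eta>) * norm q ^ n" for N n
  proof -
    have "norm (term21 (w * q ^ N) n) = norm (qpoch (- q) q n) * norm q ^ Suc n /
      (norm (qpoch (inverse (w * q ^ N)) q (Suc n)) * norm (qpoch (w * q * q ^ N) q (Suc n)))"
      by (simp add: term21_def norm_mult norm_divide norm_power mult_ac)
    also have "\<dots> \<le> M * norm q ^ n / (\<epsilon> * \<eta>)"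
    proof (intro frac_le mult_mono)
      show "norm q ^ Suc n \<le> norm q ^ n" using q1 by (intro power_decreasing) auto
    qed (use \<eta> \<epsilon> norm_qpoch_le[of "- q" n] in \<open>auto simp: M_def\<close>)
    finally show ?thesis by simp
  qed
  show "summable (term21 w)" "Bseq (\<lambda>N. \<Sum>n. term21 (w * q ^ N) n)"
    using geometric_family_bound(1)[where t = "\<lambda>N. term21 (w * q ^ N)" and N = 0, OF bound _ q1]
      geometric_family_bound(2)[where t = "\<lambda>N. term21 (w * q ^ N)", OF bound _ q1]
    by simp_all
qed

lemma
  assumes "generic x"
  shows summable_term22: "summable (term22 x)"
    and Bseq_term22: "Bseq (\<lambda>N. \<Sum>n. term22 (x * q ^ N) n)"
proof -
  obtain \<eta> where \<eta>: "\<eta> > 0" "\<And>N n. \<eta> \<le> norm (qpoch (x * q ^ N) q n)"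
    using qpoch_bounded_below_up generic_mult_power_ne_1[OF assms] by metis
  \<comment> \<open>Since q/x = 1/(x/q), the lower bound for the factor in q/x is obtained by
    starting the orbit at x/q.\<close>
  have "generic (x * inverse q)" using generic_mult_powi[OF assms, of "-1"] by simp
  then obtain \<epsilon> where "\<epsilon> > 0" and \<epsilon>: "\<And>N n. \<epsilon> \<le> norm (qpoch (inverse (x * inverse q * q ^ N)) q n)"
    using qpoch_bounded_below_down unfolding generic_def by metis
  then have \<epsilon>: "\<epsilon> > 0" "\<And>N n. \<epsilon> \<le> norm (qpoch (inverse (x * q ^ N) * q) q n)"
    using \<epsilon> by (simp_all add: mult_ac)
  define M where "M = exp (norm (- 1 :: complex) / (1 - norm q))"
  have bound: "norm (term22 (x * q ^ N) n) \<le> (1 + norm x) * M / (2 * \<eta> * \<epsilon>) * norm q ^ n" for N n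
  proof -
    \<comment> \<open>Absorbing 1 - x into the factorial, (1-x) (xq)_n = (x)_(n+1), lets one lower
      bound cover the prefactor too.\<close>
    have "term22 (x * q ^ N) n = - ((1 + x * q ^ N) * qpoch (- 1) q n * q ^ n /
      (2 * qpoch (x * q ^ N) q (Suc n) * qpoch (inverse (x * q ^ N) * q) q n))"
    proof -
      have "- a / (2 * d) * (b * c / (e * f)) = - (a * b * c / (2 * (d * e) * f))" for a b c d e f :: complex
        by (simp add: mult.assoc)
      then show ?thesis unfolding term22_def qpoch_Suc_shift .
    qed
    then have "norm (term22 (x * q ^ N) n) = norm (1 + x * q ^ N) * norm (qpoch (- 1) q n) * norm q ^ n /
      (2 * norm (qpoch (x * q ^ N) q (Suc n)) * norm (qpoch (inverse (x * q ^ N) * q) q n))"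
      by (simp only: norm_minus_cancel norm_divide norm_mult norm_power) simp
    also have "\<dots> \<le> (1 + norm x) * M * norm q ^ n / (2 * \<eta> * \<epsilon>)"
    proof (intro frac_le mult_mono)
      have "norm (1 + x * q ^ N) \<le> 1 + norm x * norm q ^ N"
        using norm_triangle_ineq[of 1 "x * q ^ N"] by (simp add: norm_mult norm_power)
      also have "norm x * norm q ^ N \<le> norm x * 1"
        using q1 by (intro mult_left_mono power_le_one) auto
      finally show "norm (1 + x * q ^ N) \<le> 1 + norm x" by simp
    qed (use \<eta> \<epsilon> norm_qpoch_le[of "-1" n] in \<open>auto simp: M_def add_nonneg_nonneg\<close>)
    finally show ?thesis by simp
  qed
  show "summable (term22 x)" "Bseq (\<lambda>N. \<Sum>n. term22 (x * q ^ N) n)"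
    using geometric_family_bound(1)[where t = "\<lambda>N. term22 (x * q ^ N)" and N = 0, OF bound _ q1]
      geometric_family_bound(2)[where t = "\<lambda>N. term22 (x * q ^ N)", OF bound _ q1]
    by simp_all
qed

lemma norm_mult_power_le: "norm (a * q ^ k) \<le> norm a"
proof -
  have "norm a * norm q ^ k \<le> norm a * 1"
    using q1 by (intro mult_left_mono power_le_one) auto
  then show ?thesis by (simp add: norm_mult norm_power)
qed

text \<open>Here the decay comes from x^n instead of q^n. The numerator also moves with N, but its
  argument never exceeds |x| in norm, so M serves for all N.\<close>

lemma
  assumes "norm x < 1"
  shows summable_term23: "summable (term23 x)"
    and Bseq_term23: "Bseq (\<lambda>N. \<Sum>n. term23 (x * q ^ N) n)"
proof -
  have "x * q * q ^ j \<noteq> 1" for j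
    using norm_mult_power_le[of x "Suc j"] assms by (auto simp: mult_ac)
  then obtain \<eta> where \<eta>: "\<eta> > 0" "\<And>N n. \<eta> \<le> norm (qpoch (x * q * q ^ N) q n)"
    using qpoch_bounded_below_up by metis
  define M where "M = exp (norm x / (1 - norm q))"
  have M: "norm (qpoch (- (x * q ^ N) * q) q n) \<le> M" for N n
  proof -
    have "norm (- (x * q ^ N) * q) \<le> norm x"
      using norm_mult_power_le[of x "Suc N"] by (simp add: mult_ac)
    then have "exp (norm (- (x * q ^ N) * q) / (1 - norm q)) \<le> M"
      unfolding M_def using q1 by (auto intro: divide_right_mono)
    then show ?thesis using norm_qpoch_le order_trans by blast
  qed
  have bound: "norm (term23 (x * q ^ N) n) \<le> 2 * M / \<eta> * norm x ^ n" for N n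
  proof -
    have "norm (term23 (x * q ^ N) n) = norm (1 + x * q ^ N) * norm (qpoch (- (x * q ^ N) * q) q n)
            * norm (x * q ^ N) ^ n / norm (qpoch (x * q * q ^ N) q n)"
      by (simp add: term23_def norm_divide norm_power norm_mult mult_ac)
    also have "\<dots> \<le> 2 * M * norm x ^ n / \<eta>"
    proof (intro frac_le mult_mono power_mono norm_mult_power_le M)
      show "norm (1 + x * q ^ N) \<le> 2"
        using norm_triangle_ineq[of 1 "x * q ^ N"] norm_mult_power_le[of x N] assms by simp
    qed (use \<eta> in \<open>auto simp: M_def\<close>)
    finally show ?thesis by simp
  qed
  show "summable (term23 x)" "Bseq (\<lambda>N. \<Sum>n. term23 (x * q ^ N) n)"
    using geometric_family_bound(1)[where t = "\<lambda>N. term23 (x * q ^ N)" and N = 0, OF bound _ assms]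
      geometric_family_bound(2)[where t = "\<lambda>N. term23 (x * q ^ N)", OF bound _ assms]
    by simp_all
qed

section \<open>Telescoping proofs of the three functional equations\<close>

lemma suminf_shift_telescope:
  fixes s t U :: "nat \<Rightarrow> complex"
  assumes "summable s" "summable t" "\<And>n. s n + a * t n = U (Suc n) - U n" "U \<longlonglongrightarrow> L"
  shows "suminf s = L - U 0 - a * suminf t"
proof -
  have "(\<lambda>n. s n + a * t n) sums (suminf s + a * suminf t)"
    using assms(1,2) by (intro sums_add sums_mult summable_sums)
  moreover have "(\<lambda>n. s n + a * t n) sums (L - U 0)"
    unfolding assms(3) using assms(4) by (rule telescope_sums)
  ultimately have "suminf s + a * suminf t = L - U 0" by (rule sums_unique2)
  then show ?thesis by (simp add: algebra_simps)
qed

lemma suminf_term21_shift: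
  assumes w: "generic w"
  shows "(\<Sum>n. term21 w n) = w * q * (1 - w * q) * qpoch_inf (- q) q / theta_denom w - w * q
           - (w * q)\<^sup>2 * (\<Sum>n. term21 (w * q) n)"
proof -
  \<comment> \<open>The summands at w and at wq share the denominators (wq^2)_n and (1/w)_n. U keeps
    just these, and the scalar wq makes the remaining rational identity in w, q and Q = q^n
    hold.\<close>
  define U where "U n = w * q * (qpoch (- q) q n / (qpoch (w * q * q) q n * qpoch (inverse w) q n))" for n
  have w0: "w \<noteq> 0" using w by (rule generic_nonzero)
  have gs: "generic (w * q)" "generic (w * q * q)" "generic (inverse w)"
    using w by (auto intro: generic_mult_q generic_inverse)
  have rec: "term21 w n + (w * q)\<^sup>2 * term21 (w * q) n = U (Suc n) - U n" for n
  proof -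
    define P A C Q where "P = qpoch (- q) q n" and "A = qpoch (w * q * q) q n"
      and "C = qpoch (inverse w) q n" and "Q = q ^ n"
    have nz: "A \<noteq> 0" "C \<noteq> 0" "1 - w * q \<noteq> 0" "1 - w * q * q * Q \<noteq> 0" "w - Q \<noteq> 0"
      using generic_qpoch_nonzero gs generic_mult_power_ne_1[OF w, of 1]
        generic_mult_power_ne_1[OF gs(2), of n] generic_mult_power_ne_1[OF gs(3), of n] w0
      by (auto simp: A_def C_def Q_def field_simps)
    have C': "1 - inverse w * Q = (w - Q) / w" using w0 by (simp add: field_simps)
    have e: "qpoch (- q) q (Suc n) = P * (1 + q * Q)"
      "qpoch (inverse w) q (Suc n) = C * (w - Q) / w"
      "qpoch (w * q * q) q (Suc n) = A * (1 - w * q * q * Q)"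
      "q ^ Suc n = q * Q"
      by (simp_all add: qpoch_Suc C' P_def[symmetric] C_def[symmetric] A_def[symmetric] Q_def[symmetric])
    have e': "qpoch (w * q) q (Suc n) = (1 - w * q) * A"
      "qpoch (inverse (w * q)) q (Suc n) = - (1 - w * q) * C / (w * q)"
      using w0 q_nonzero by (simp_all add: qpoch_Suc_shift A_def C_def field_simps)
    show ?thesis
      unfolding term21_def U_def e e' P_def[symmetric] A_def[symmetric] C_def[symmetric]
      using nz w0 q_nonzero
      by (simp add: divide_simps) (simp add: algebra_simps power2_eq_square)
  qed
  have lim: "U \<longlonglongrightarrow> w * q * (qpoch_inf (- q) q / (qpoch_inf (w * q * q) q * qpoch_inf (inverse w) q))"
    unfolding U_def using gs by (intro tendsto_intros qpoch_tendsto) (simp add: generic_qpoch_inf_nonzero)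
  \<comment> \<open>The limit contains (wq^2)_inf; restoring its missing first factor produces
    \<open>theta_denom w\<close> and the numerator 1 - wq.\<close>
  have "1 - w * q \<noteq> 0" using generic_mult_power_ne_1[OF w, of 1] by simp
  then have "w * q * (qpoch_inf (- q) q / (qpoch_inf (w * q * q) q * qpoch_inf (inverse w) q))
     = w * q * (1 - w * q) * qpoch_inf (- q) q / theta_denom w"
    using qpoch_inf_shift[of "w * q"] by (simp add: theta_denom_def)
  with suminf_shift_telescope[OF summable_term21[OF w] summable_term21[OF gs(1)] rec lim]
  show ?thesis by (simp add: U_def)
qed

lemma suminf_term22_shift:
  assumes x: "generic x"
  shows "(\<Sum>n. term22 x n) = (1 - x\<^sup>2 * q) * qpoch_inf (- q) q / theta_denom x - (1 - x\<^sup>2 * q) / 2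
           - x\<^sup>2 * q * (\<Sum>n. term22 (x * q) n)"
proof -
  \<comment> \<open>The common denominators at x and xq are now (xq)_n and (1/x)_n. The 1/2 will
    cancel the first factor of (-1)_inf = 2 (-q)_inf.\<close>
  define U where "U n = (1 - x\<^sup>2 * q) / 2 * (qpoch (- 1) q n / (qpoch (x * q) q n * qpoch (inverse x) q n))" for n
  have x0: "x \<noteq> 0" using x by (rule generic_nonzero)
  have gs: "generic (x * q)" "generic (inverse x)"
    using x by (auto intro: generic_mult_q generic_inverse)
  have rec: "term22 x n + x\<^sup>2 * q * term22 (x * q) n = U (Suc n) - U n" for n
  proof -
    define P A C Q where "P = qpoch (- 1) q n" and "A = qpoch (x * q) q n"
      and "C = qpoch (inverse x) q n" and "Q = q ^ n"
    have nz: "A \<noteq> 0" "C \<noteq> 0" "1 - x \<noteq> 0" "1 - x * q \<noteq> 0" "1 - x * q * Q \<noteq> 0" "x - Q \<noteq> 0"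
      using generic_qpoch_nonzero gs generic_mult_power_ne_1[OF x, of 1] generic_mult_power_ne_1[OF x, of 0]
        generic_mult_power_ne_1[OF gs(1), of n] generic_mult_power_ne_1[OF gs(2), of n] x0
      by (auto simp: A_def C_def Q_def field_simps)
    have C': "1 - inverse x * Q = (x - Q) / x" using x0 by (simp add: field_simps)
    have e: "qpoch (- 1) q (Suc n) = P * (1 + Q)"
      "qpoch (inverse x) q (Suc n) = C * (x - Q) / x"
      "qpoch (x * q) q (Suc n) = A * (1 - x * q * Q)"
      by (simp_all add: qpoch_Suc P_def[symmetric] C' C_def[symmetric] A_def[symmetric] Q_def[symmetric])
    have "(1 - inverse x) * qpoch (inverse x * q) q n = C * (x - Q) / x"
      using e(2) by (simp add: qpoch_Suc_shift)
    moreover have "1 - inverse x = - (1 - x) / x" using x0 by (simp add: field_simps)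
    ultimately have 1: "qpoch (inverse x * q) q n = - C * (x - Q) / (1 - x)"
      using nz x0 by (simp add: field_simps)
    have "(1 - x * q) * qpoch (x * q * q) q n = A * (1 - x * q * Q)"
      using e(3) by (simp add: qpoch_Suc_shift)
    then have 2: "qpoch (x * q * q) q n = A * (1 - x * q * Q) / (1 - x * q)"
      using nz by (simp add: field_simps)
    have 3: "inverse (x * q) * q = inverse x" using q_nonzero by simp
    show ?thesis
      unfolding term22_def U_def e 1 2 3 P_def[symmetric] A_def[symmetric] C_def[symmetric] Q_def[symmetric]
      using nz x0 
      by (simp add: divide_simps) (simp add: algebra_simps power2_eq_square)
  qed
  have lim: "U \<longlonglongrightarrow> (1 - x\<^sup>2 * q) / 2 * (qpoch_inf (- 1) q / (qpoch_inf (x * q) q * qpoch_inf (inverse x) q))"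
    unfolding U_def using gs by (intro tendsto_intros qpoch_tendsto) (simp_all add: generic_qpoch_inf_nonzero)
  have "qpoch_inf (- 1) q = 2 * qpoch_inf (- q) q" using qpoch_inf_shift[of "- 1"] by simp
  with suminf_shift_telescope[OF summable_term22[OF x] summable_term22[OF gs(1)] rec lim]
  show ?thesis by (simp add: U_def theta_denom_def)
qed

lemma suminf_term23_shift:
  assumes x: "norm x < 1"
  shows "(\<Sum>n. term23 x n) = 1 - x\<^sup>2 * q - x\<^sup>2 * q * (\<Sum>n. term23 (x * q) n)"
proof -
  define U where "U n = (- x) ^ n * (qpoch (- x * q) q n / qpoch (x * q) q n) * (x\<^sup>2 * q * q ^ n - 1)" for n
  have small: "norm (x * q ^ k) < 1" for k using norm_mult_power_le[of x k] x by linarith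
  have ne: "x * q ^ k \<noteq> 1" "x * q ^ k \<noteq> - 1" for k using small[of k] by auto
  have "x * q * q ^ j \<noteq> 1" for j using ne(1)[of "Suc j"] by (simp add: mult_ac)
  then have nz0: "qpoch (x * q) q n \<noteq> 0" "qpoch_inf (x * q) q \<noteq> 0" for n
    by (simp_all add: qpoch_def qpoch_inf_nonzero)
  \<comment> \<open>What remains of the recursion after clearing denominators, with (-x)^n and q^n
    replaced by free T and Q.\<close>
  have poly: "(1 + x) * (P * (T * (1 - x * q * Q))) + x\<^sup>2 * q * (P * (1 + x * q * Q) * (1 - x * q) * (T * Q)) =
      - (x * T * (P * (1 + x * q * Q)) * (x\<^sup>2 * q * (q * Q) - 1)) - T * P * (x\<^sup>2 * q * Q - 1) * (1 - x * q * Q)"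
    for P T Q :: complex by (simp add: algebra_simps power2_eq_square)
  have rec: "term23 x n + x\<^sup>2 * q * term23 (x * q) n = U (Suc n) - U n" for n
  proof -
    define P A Q T where "P = qpoch (- x * q) q n" and "A = qpoch (x * q) q n" and "Q = q ^ n"
      and "T = (- x) ^ n"
    have nz: "A \<noteq> 0" "1 - x * q \<noteq> 0" "1 + x * q \<noteq> 0" "1 - x * q * Q \<noteq> 0"
      using nz0 ne(1)[of 1] ne(2)[of 1] ne(1)[of "Suc n"]
      by (auto simp: A_def Q_def mult_ac add_eq_0_iff)
    have e: "qpoch (- x * q) q (Suc n) = P * (1 + x * q * Q)" "qpoch (x * q) q (Suc n) = A * (1 - x * q * Q)"
      by (simp_all add: qpoch_Suc P_def Q_def A_def)
    have 1: "qpoch (x * q * q) q n = A * (1 - x * q * Q) / (1 - x * q)"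
      using e(2) nz by (simp add: qpoch_Suc_shift field_simps)
    have 2: "qpoch (- (x * q) * q) q n = P * (1 + x * q * Q) / (1 + x * q)"
      using e(1) nz by (simp add: qpoch_Suc_shift field_simps)
    have 3: "(- (x * q)) ^ n = T * Q" "(- x) ^ Suc n = - x * T" "q ^ Suc n = q * Q"
      by (simp_all add: Q_def T_def flip: power_mult_distrib)
    show ?thesis
      unfolding term23_def U_def e 1 2 3 P_def[symmetric] A_def[symmetric] Q_def[symmetric] T_def[symmetric]
      using nz poly[of P T Q] by (simp add: divide_simps)
  qed
  \<comment> \<open>The factor (-x)^n sends U to 0 because |x| < 1, which is why no infinite product
    survives here.\<close>
  have "U \<longlonglongrightarrow> 0 * (qpoch_inf (- x * q) q / qpoch_inf (x * q) q) * (x\<^sup>2 * q * 0 - 1)"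
    unfolding U_def using nz0(2) q1 x by (intro tendsto_intros qpoch_tendsto LIMSEQ_power_zero) simp_all
  then have lim: "U \<longlonglongrightarrow> 0" by simp
  have "norm (x * q) < 1" using small[of 1] by simp
  from suminf_shift_telescope[OF summable_term23[OF x] summable_term23[OF this] rec lim]
  show ?thesis by (simp add: U_def)
qed

subsection \<open>Partial theta expansions\<close>

text \<open>The product of the first k coefficients -(x q^j)^2 q of the iteration; the power of q is
  1 + 3 + ... + (2k-1) = k^2.\<close>

definition ptheta :: "complex \<Rightarrow> nat \<Rightarrow> complex" where
  "ptheta x k = (- 1) ^ k * x ^ (2 * k) * q ^ k\<^sup>2"

lemma ptheta_0 [simp]: "ptheta x 0 = 1"
  by (simp add: ptheta_def)

lemma ptheta_Suc: "ptheta x (Suc k) = ptheta x k * - ((x * q ^ k)\<^sup>2 * q)"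
proof -
  have "(Suc k)\<^sup>2 = k\<^sup>2 + (k + k + 1)" by (simp add: power2_eq_square)
  then show ?thesis by (simp add: ptheta_def power_add power2_eq_square[of "_ * _"] mult_ac)
qed

lemma ptheta_alt: "ptheta x k = (- (x\<^sup>2)) ^ k * q ^ k\<^sup>2"
  by (simp add: ptheta_def power_minus[of "x\<^sup>2"] power_mult)

lemma summable_ptheta: "summable (ptheta x)"
  unfolding ptheta_alt by (rule summable_quadratic) (simp add: power2_eq_square)

lemma prod_ptheta: "(\<Prod>j<k. - ((x * q ^ j)\<^sup>2 * q)) = ptheta x k"
  by (induction k) (simp_all add: ptheta_Suc)

lemma psi3_eq: "\<psi>3 w q = - w * suminf (ptheta w)"
  unfolding \<psi>3_def
  by (subst suminf_mult[OF summable_ptheta, symmetric]) (simp add: ptheta_def mult_ac)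

lemma ptheta_Suc_sums: "(\<lambda>k. ptheta w (Suc k)) sums (suminf (ptheta w) - 1)"
  using summable_sums[OF summable_ptheta, of w] by (simp add: sums_Suc_iff)

text \<open>The k-th iterate contributes \<open>ptheta x k + ptheta x (Suc k)\<close>, so every term
  of the partial theta series is counted twice except the initial 1.\<close>

lemma suminf_term23_eq:
  assumes x: "norm x < 1"
  shows "(\<Sum>n. term23 x n) = 2 * suminf (ptheta x) - 1"
proof -
  have "(\<lambda>k. (\<Prod>j<k. - ((x * q ^ j)\<^sup>2 * q)) * (1 - (x * q ^ k)\<^sup>2 * q)) sums (\<Sum>n. term23 (x * q ^ 0) n)"
  proof (rule tendsto_iterate_sums)
    fix k
    have "norm (x * q ^ k) < 1" using norm_mult_power_le[of x k] x by linarith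
    from suminf_term23_shift[OF this] show "(\<Sum>n. term23 (x * q ^ k) n) = 1 - (x * q ^ k)\<^sup>2 * q +
      - ((x * q ^ k)\<^sup>2 * q) * (\<Sum>n. term23 (x * q ^ Suc k) n)"
      by (simp add: mult_ac)
  qed (use Bseq_term23[OF x] summable_LIMSEQ_zero[OF summable_ptheta] in \<open>simp_all add: prod_ptheta\<close>)
  then have "(\<lambda>k. ptheta x k + ptheta x (Suc k)) sums (\<Sum>n. term23 x n)"
    unfolding prod_ptheta by (simp add: ptheta_Suc algebra_simps)
  moreover have "(\<lambda>k. ptheta x k + ptheta x (Suc k)) sums (suminf (ptheta x) + (suminf (ptheta x) - 1))"
    by (intro sums_add summable_sums summable_ptheta ptheta_Suc_sums)
  ultimately show ?thesis using sums_unique2 by fastforce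
qed

lemma inverse_theta_denom:
  assumes "generic w"
  shows "inverse (theta_denom (w * q ^ k)) = (- w) ^ k * q ^ tri k / theta_denom w"
  using theta_denom_shift_power[OF assms, of k] theta_denom_nonzero[OF assms]
    theta_denom_nonzero[OF generic_mult_power[OF assms, of k]]
  by (simp add: divide_simps)

text \<open>The square comes from the iteration coefficients, the single power from
  quasi-periodicity of \<open>theta_denom\<close>; the signs cancel and the cube remains.\<close>

lemma minus_square_power: "(- (w\<^sup>2)) ^ k * (- w) ^ k = (w :: complex) ^ (3 * k)"
proof -
  have "- (w\<^sup>2) * - w = w ^ 3" by (simp add: power2_eq_square power3_eq_cube)
  then show ?thesis by (metis power_mult power_mult_distrib)
qed

definition psi4_term :: "complex \<Rightarrow> nat \<Rightarrow> complex" where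
  "psi4_term w k = w ^ (3 * k + 1) * q ^ (3 * tri k + k + 1) * (1 - w * q ^ Suc k)"

text \<open>One term pairs the indices 6k + 1 and 6k + 5 of the Kronecker series at -x, in the shape
  in which the iteration delivers them.\<close>

definition psi1_term :: "complex \<Rightarrow> nat \<Rightarrow> complex" where
  "psi1_term x k = x ^ (3 * k) * q ^ (k\<^sup>2 + tri k) * (1 - x\<^sup>2 * q ^ (2 * k + 1))"

lemma psi4_sums: "psi4_term w sums \<psi>4 w q"
proof -
  have "summable (\<lambda>k. w * ((w ^ 3) ^ k * q ^ (3 * tri k + k + 1))
          - w\<^sup>2 * ((w ^ 3) ^ k * q ^ (3 * tri k + k + 1 + Suc k)))"
  proof (intro summable_diff summable_mult summable_quadratic)
    show "n * n \<le> 2 * (3 * tri n + n + 1) + n" for n :: nat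
      using double_tri[of n] by simp
    show "n * n \<le> 2 * (3 * tri n + n + 1 + Suc n) + n" for n :: nat
      using double_tri[of n] by simp
  qed
  also have "(\<lambda>k. w * ((w ^ 3) ^ k * q ^ (3 * tri k + k + 1))
      - w\<^sup>2 * ((w ^ 3) ^ k * q ^ (3 * tri k + k + 1 + Suc k))) = psi4_term w"
  proof
    fix k
    have pw: "w ^ (3 * k + 1) = w * (w ^ 3) ^ k" by (simp add: power_mult)
    show "w * ((w ^ 3) ^ k * q ^ (3 * tri k + k + 1))
        - w\<^sup>2 * ((w ^ 3) ^ k * q ^ (3 * tri k + k + 1 + Suc k)) = psi4_term w k"
      unfolding psi4_term_def pw power_add[of q _ "Suc k"] by (simp add: algebra_simps power2_eq_square)
  qed
  finally have "psi4_term w sums suminf (psi4_term w)" by (rule summable_sums)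
  moreover have "\<psi>4 w q = suminf (psi4_term w)"
    unfolding \<psi>4_def
  proof (intro suminf_cong)
    fix k
    have "3 * (Suc k)\<^sup>2 - Suc k = 2 * (3 * tri k + k + 1)"
      using double_tri[of k] by (simp add: power2_eq_square)
    then have "(3 * (Suc k)\<^sup>2 - Suc k) div 2 = 3 * tri k + k + 1" by simp
    moreover have "3 * Suc k - 2 = 3 * k + 1" by simp
    ultimately show "(let n = Suc k in w ^ (3 * n - 2) * q ^ ((3 * n\<^sup>2 - n) div 2) * (1 - w * q ^ n))
        = psi4_term w k"
      by (simp only: Let_def psi4_term_def)
  qed
  ultimately show ?thesis by simp
qed

lemma suminf_term21_eq:
  assumes w: "generic w"
  shows "(\<Sum>n. term21 w n) = inverse w * (suminf (ptheta w) - 1)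
           + qpoch_inf (- q) q / theta_denom w * \<psi>4 w q"
proof -
  let ?c = "qpoch_inf (- q) q"
  let ?r = "\<lambda>k. w * q ^ k * q * (1 - w * q ^ k * q) * ?c / theta_denom (w * q ^ k) - w * q ^ k * q"
  have w0: "w \<noteq> 0" using w by (rule generic_nonzero)
  have pr: "(\<Prod>j<k. - ((w * q ^ j * q)\<^sup>2)) = (- (w\<^sup>2)) ^ k * q ^ (k * (k + 1))" for k
  proof (induction k)
    case (Suc k)
    have "Suc k * (Suc k + 1) = k * (k + 1) + (k + k + 2)" by simp
    with Suc show ?case by (simp only: prod.lessThan_Suc power_add) (simp add: power2_eq_square mult_ac)
  qed simp
  have lim: "(\<lambda>k. \<Prod>j<k. - ((w * q ^ j * q)\<^sup>2)) \<longlonglongrightarrow> 0"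
    unfolding pr by (intro summable_LIMSEQ_zero summable_quadratic) simp
  have "(\<lambda>k. (\<Prod>j<k. - ((w * q ^ j * q)\<^sup>2)) * ?r k) sums (\<Sum>n. term21 (w * q ^ 0) n)"
  proof (rule tendsto_iterate_sums)
    fix k
    show "(\<Sum>n. term21 (w * q ^ k) n) = ?r k + - ((w * q ^ k * q)\<^sup>2) * (\<Sum>n. term21 (w * q ^ Suc k) n)"
      using suminf_term21_shift[OF generic_mult_power[OF w, of k]] by (simp add: mult_ac)
  qed (use Bseq_term21[OF w] lim in simp_all)
  moreover have "(\<Prod>j<k. - ((w * q ^ j * q)\<^sup>2)) * ?r k
      = inverse w * ptheta w (Suc k) + ?c / theta_denom w * psi4_term w k" for k
  proof -
    let ?T = "tri k"
    have T: "k * (k + 1) = ?T + ?T"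
      using double_tri[of k] by simp
    \<comment> \<open>The coefficient is -(wq)^2, so the exponent is k(k+1); the boundary factor
      adds k + 1 and completes the square (k+1)^2. Hence the partial theta series starts at index
      1.\<close>
    have 1: "(- (w\<^sup>2)) ^ k * q ^ (k * (k + 1)) * (w * q ^ k * q) = - inverse w * ptheta w (Suc k)"
      using w0 by (simp add: ptheta_Suc ptheta_alt power_add power2_eq_square field_simps)
    have "(- (w\<^sup>2)) ^ k * q ^ (k * (k + 1)) * (w * q ^ k * q * (1 - w * q ^ k * q) * ?c / theta_denom (w * q ^ k))
       = ?c * (w * q ^ k * q * (1 - w * q ^ k * q)) * q ^ (k * (k + 1)) *
          ((- (w\<^sup>2)) ^ k * inverse (theta_denom (w * q ^ k)))"
      by (simp add: divide_inverse mult_ac)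
    also have "(- (w\<^sup>2)) ^ k * inverse (theta_denom (w * q ^ k)) = w ^ (3 * k) * q ^ ?T / theta_denom w"
      unfolding inverse_theta_denom[OF w] by (simp flip: minus_square_power)
    also have "?c * (w * q ^ k * q * (1 - w * q ^ k * q)) * q ^ (k * (k + 1)) * (w ^ (3 * k) * q ^ ?T / theta_denom w)
       = ?c / theta_denom w * psi4_term w k"
    proof -
      have "3 * ?T = ?T + ?T + ?T" by simp
      then show ?thesis unfolding psi4_term_def T by (simp only: power_add) (simp add: mult_ac)
    qed
    finally show ?thesis unfolding pr right_diff_distrib 1 by simp
  qed
  ultimately have "(\<lambda>k. inverse w * ptheta w (Suc k) + ?c / theta_denom w * psi4_term w k) sums (\<Sum>n. term21 w n)"
    by simp
  moreover have "(\<lambda>k. inverse w * ptheta w (Suc k) + ?c / theta_denom w * psi4_term w k) sums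
      (inverse w * (suminf (ptheta w) - 1) + ?c / theta_denom w * \<psi>4 w q)"
    by (intro sums_add sums_mult ptheta_Suc_sums psi4_sums)
  ultimately show ?thesis by (rule sums_unique2)
qed

lemma summable_psi1_terms:
  "summable (\<lambda>k. x ^ (3 * k) * q ^ (k\<^sup>2 + tri k))"
  "summable (\<lambda>k. x ^ (3 * k + 2) * q ^ (k\<^sup>2 + tri k + 2 * k + 1))"
proof -
  have "summable (\<lambda>k. (x ^ 3) ^ k * q ^ (k\<^sup>2 + tri k))"
    by (intro summable_quadratic) (simp add: power2_eq_square)
  then show "summable (\<lambda>k. x ^ (3 * k) * q ^ (k\<^sup>2 + tri k))"
    by (simp only: power_mult)
  have "summable (\<lambda>k. x\<^sup>2 * ((x ^ 3) ^ k * q ^ (k\<^sup>2 + tri k + 2 * k + 1)))"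
    by (intro summable_mult summable_quadratic) (simp add: power2_eq_square)
  moreover have "x ^ (3 * k + 2) = x\<^sup>2 * (x ^ 3) ^ k" for k
    by (simp only: power_add power_mult) (rule mult.commute)
  ultimately show "summable (\<lambda>k. x ^ (3 * k + 2) * q ^ (k\<^sup>2 + tri k + 2 * k + 1))"
    by (simp only: mult.assoc)
qed

lemma psi1_term_split: "psi1_term x k = x ^ (3 * k) * q ^ (k\<^sup>2 + tri k)
    - x ^ (3 * k + 2) * q ^ (k\<^sup>2 + tri k + 2 * k + 1)"
  unfolding psi1_term_def power_add right_diff_distrib by (simp add: mult_ac)

lemma summable_psi1_term: "summable (psi1_term x)"
  unfolding psi1_term_split by (intro summable_diff summable_psi1_terms)

text \<open>The series lives on the classes 1 and 5 mod 6. Each half is a reindexed series that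
  converges by itself, so adding them gives the paired form.\<close>

lemma kronecker_series_sums:
  "(\<lambda>n. of_int (kronecker 12 (int n)) * (- x) ^ ((n - 1) div 2) * q ^ ((n\<^sup>2 - 1) div 24))
     sums suminf (psi1_term x)"
proof -
  define f where "f n = of_int (chi12 n) * (- x) ^ ((n - 1) div 2) * q ^ ((n\<^sup>2 - 1) div 24)" for n
  define f1 where "f1 n = (if n mod 6 = 1 then f n else 0)" for n
  define f5 where "f5 n = (if n mod 6 = 5 then f n else 0)" for n
  \<comment> \<open>The alternation of the character cancels the sign of (-x)^(3m).\<close>
  have sgn: "(- 1) ^ m * (- x) ^ (3 * m) = x ^ (3 * m)" for m
    by (simp add: power_mult power_minus[of "x ^ 3"])
  have sq1: "((6 * m + 1)\<^sup>2 - 1) div 24 = m\<^sup>2 + tri m" for m :: nat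
  proof -
    have "(6 * m + 1)\<^sup>2 - 1 = 24 * (m\<^sup>2 + tri m)"
      using double_tri[of m] by (simp add: power2_eq_square)
    then show ?thesis by simp
  qed
  have sq5: "((6 * m + 5)\<^sup>2 - 1) div 24 = m\<^sup>2 + tri m + 2 * m + 1" for m :: nat
  proof -
    have "(6 * m + 5)\<^sup>2 = 36 * (m * m) + 60 * m + 25"
      by (simp add: power2_eq_square algebra_simps)
    then have "(6 * m + 5)\<^sup>2 - 1 = 24 * (m\<^sup>2 + tri m + 2 * m + 1)"
      using double_tri[of m] by (simp only:) (simp add: power2_eq_square)
    then show ?thesis by simp
  qed
  have h1: "(6 * m + 1 - 1) div 2 = 3 * m" for m :: nat by simp
  have h5: "(6 * m + 5 - 1) div 2 = 3 * m + 2" for m :: nat by simp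
  have m1: "(6 * m + 1) mod 6 = 1" and m5: "(6 * m + 5) mod 6 = 5" for m :: nat
    by (simp_all only: mod_mult_self4) simp_all
  have f1: "f1 (6 * m + 1) = x ^ (3 * m) * q ^ (m\<^sup>2 + tri m)" for m
    unfolding f1_def f_def m1 h1 sq1 chi12_1_mod_6 by (simp add: sgn)
  have f5: "f5 (6 * m + 5) = - (x ^ (3 * m + 2) * q ^ (m\<^sup>2 + tri m + 2 * m + 1))" for m
    unfolding f5_def f_def m5 h5 sq5 chi12_5_mod_6
    by (simp only: if_True refl power_add[of "- x"] power_add[of x] sgn[symmetric]) simp
  have "f1 sums (\<Sum>m. f1 (6 * m + 1))"
  proof (subst sums_mono_reindex[of "\<lambda>m. 6 * m + 1", symmetric])
    show "f1 n = 0" if "n \<notin> range (\<lambda>m. 6 * m + 1)" for n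
      using that mult_div_mod_eq[of 6 n] unfolding f1_def by (metis rangeI)
    show "(\<lambda>n. f1 (6 * n + 1)) sums (\<Sum>m. f1 (6 * m + 1))"
      unfolding f1 by (intro summable_sums summable_psi1_terms)
  qed (simp add: strict_mono_def)
  moreover have "f5 sums (\<Sum>m. f5 (6 * m + 5))"
  proof (subst sums_mono_reindex[of "\<lambda>m. 6 * m + 5", symmetric])
    show "f5 n = 0" if "n \<notin> range (\<lambda>m. 6 * m + 5)" for n
      using that mult_div_mod_eq[of 6 n] unfolding f5_def by (metis rangeI)
    show "(\<lambda>n. f5 (6 * n + 5)) sums (\<Sum>m. f5 (6 * m + 5))"
      unfolding f5 by (intro summable_sums summable_minus summable_psi1_terms)
  qed (simp add: strict_mono_def)
  ultimately have "(\<lambda>n. f1 n + f5 n) sums ((\<Sum>m. f1 (6 * m + 1)) + (\<Sum>m. f5 (6 * m + 5)))"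
    by (rule sums_add)
  also have "(\<Sum>m. f1 (6 * m + 1)) + (\<Sum>m. f5 (6 * m + 5)) = suminf (psi1_term x)"
  proof -
    have "psi1_term x = (\<lambda>m. x ^ (3 * m) * q ^ (m\<^sup>2 + tri m)
        + - (x ^ (3 * m + 2) * q ^ (m\<^sup>2 + tri m + 2 * m + 1)))"
      by (simp add: fun_eq_iff psi1_term_split)
    then show ?thesis
      unfolding f1 f5 using suminf_add[OF summable_psi1_terms(1) summable_minus[OF summable_psi1_terms(2)]]
      by simp
  qed
  also have "(\<lambda>n. f1 n + f5 n) = f"
  proof
    fix n :: nat
    have "chi12 n = 0" if "n mod 6 \<noteq> 1" "n mod 6 \<noteq> 5"
    proof -
      have "n mod 12 mod 6 = n mod 6" by (simp add: mod_mod_cancel)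
      then show ?thesis using that by (auto simp: chi12_def)
    qed
    then show "f1 n + f5 n = f n" by (auto simp: f1_def f5_def f_def)
  qed
  finally show ?thesis by (simp add: f_def kronecker_12)
qed

lemma S1_minus_eq:
  assumes x: "x \<noteq> 0"
  shows "S1 (- x) q = qpoch_inf (- q) q / theta_denom x * (x * suminf (psi1_term x))"
proof -
  \<comment> \<open>The leading -w of \<psi>1 cancels the summand 1 in \<open>S1\<close>.\<close>
  have "inverse (- x) * \<psi>1 (- x) q + 1 = x * suminf (psi1_term x)"
    unfolding \<psi>1_def sums_unique[OF kronecker_series_sums, symmetric]
    using x by (simp add: field_simps power2_eq_square)
  then show ?thesis by (simp add: S1_def theta_denom_def mult_ac)
qed

text \<open>The rational part again gives two adjacent partial theta terms, now weighted by -1/2;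
  the product part gains q^(k(k+1)/2) and becomes \<open>psi1_term\<close>.\<close>

lemma suminf_term22_eq:
  assumes x: "generic x"
  shows "(\<Sum>n. term22 x n) = 1 / 2 - suminf (ptheta x)
           + qpoch_inf (- q) q / theta_denom x * suminf (psi1_term x)"
proof -
  let ?c = "qpoch_inf (- q) q"
  let ?r = "\<lambda>k. (1 - (x * q ^ k)\<^sup>2 * q) * ?c / theta_denom (x * q ^ k) - (1 - (x * q ^ k)\<^sup>2 * q) / 2"
  have "(\<lambda>k. (\<Prod>j<k. - ((x * q ^ j)\<^sup>2 * q)) * ?r k) sums (\<Sum>n. term22 (x * q ^ 0) n)"
  proof (rule tendsto_iterate_sums)
    fix k
    show "(\<Sum>n. term22 (x * q ^ k) n) = ?r k + - ((x * q ^ k)\<^sup>2 * q) * (\<Sum>n. term22 (x * q ^ Suc k) n)"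
      using suminf_term22_shift[OF generic_mult_power[OF x, of k]] by (simp add: mult_ac)
  qed (use Bseq_term22[OF x] summable_LIMSEQ_zero[OF summable_ptheta] in \<open>simp_all add: prod_ptheta\<close>)
  moreover have "(\<Prod>j<k. - ((x * q ^ j)\<^sup>2 * q)) * ?r k
      = - (1 / 2) * (ptheta x k + ptheta x (Suc k)) + ?c / theta_denom x * psi1_term x k" for k
  proof -
    have 1: "ptheta x k * ((1 - (x * q ^ k)\<^sup>2 * q) / 2) = 1 / 2 * (ptheta x k + ptheta x (Suc k))"
      by (simp add: ptheta_Suc field_simps)
    have sq: "(x * q ^ k)\<^sup>2 * q = x\<^sup>2 * q ^ (2 * k + 1)"
      by (simp add: power_mult_distrib power_add mult.commute[of 2] flip: power_mult)
    have "ptheta x k * ((1 - (x * q ^ k)\<^sup>2 * q) * ?c / theta_denom (x * q ^ k))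
       = ?c * (1 - (x * q ^ k)\<^sup>2 * q) * q ^ k\<^sup>2 * ((- (x\<^sup>2)) ^ k * inverse (theta_denom (x * q ^ k)))"
      by (simp add: divide_inverse ptheta_alt mult_ac)
    also have "(- (x\<^sup>2)) ^ k * inverse (theta_denom (x * q ^ k))
        = x ^ (3 * k) * q ^ tri k / theta_denom x"
      unfolding inverse_theta_denom[OF x] by (simp flip: minus_square_power)
    also have "?c * (1 - (x * q ^ k)\<^sup>2 * q) * q ^ k\<^sup>2 * (x ^ (3 * k) * q ^ tri k / theta_denom x)
       = ?c / theta_denom x * psi1_term x k"
      unfolding psi1_term_def power_add[of q "k\<^sup>2"] sq by (simp add: mult_ac)
    finally show ?thesis unfolding prod_ptheta right_diff_distrib[of "ptheta x k"] 1 by simp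
  qed
  ultimately have "(\<lambda>k. - (1 / 2) * (ptheta x k + ptheta x (Suc k)) + ?c / theta_denom x * psi1_term x k)
      sums (\<Sum>n. term22 x n)"
    by simp
  moreover have "(\<lambda>k. - (1 / 2) * (ptheta x k + ptheta x (Suc k)) + ?c / theta_denom x * psi1_term x k) sums
      (- (1 / 2) * (suminf (ptheta x) + (suminf (ptheta x) - 1)) + ?c / theta_denom x * suminf (psi1_term x))"
    by (intro sums_add sums_mult ptheta_Suc_sums summable_sums summable_ptheta summable_psi1_term)
  ultimately have "(\<Sum>n. term22 x n) = - (1 / 2) * (suminf (ptheta x) + (suminf (ptheta x) - 1))
      + ?c / theta_denom x * suminf (psi1_term x)"
    by (rule sums_unique2)
  then show ?thesis by (simp add: field_simps)
qed

section \<open>Inversion of the base in the three series\<close>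

lemma inverse_q_power: "inverse q ^ n * q ^ n = 1"
  using q_nonzero by (simp flip: power_mult_distrib)

lemma g21_eq:
  assumes w: "w \<noteq> 0"
  shows "g21 w (inverse q) = (\<Sum>n. term21 w n)"
  unfolding g21_def tri_def[symmetric]
proof (intro suminf_cong)
  fix n :: nat
  let ?p = "inverse q" and ?T = "tri n"
  have T: "tri (n + 1) = ?T + (n + 1)" by (simp add: tri_Suc)
  have 1: "qpoch (- ?p) ?p n = ?p ^ ?T * qpoch (- q) q n"
    using qpoch_inverse_base[of "- ?p" q n] q_nonzero inverse_q_power[of n] by (simp add: mult_ac)
  have 2: "qpoch w ?p (n + 1) = (- w) ^ (n + 1) * ?p ^ ?T * qpoch (inverse w) q (n + 1)"
    unfolding qpoch_inverse_base[OF w q_nonzero] T power_add[of ?p ?T]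
    using inverse_q_power[of "n + 1"] by (simp only: mult.assoc) (simp only: mult.left_commute mult_1_left flip: mult.assoc)
  have 3: "qpoch (inverse w * ?p) ?p (n + 1)
      = (- (inverse w * ?p)) ^ (n + 1) * ?p ^ ?T * qpoch (w * q) q (n + 1)"
    using qpoch_inverse_base[of "inverse w * ?p" q "n + 1"] w q_nonzero inverse_q_power[of "n + 1"]
    unfolding T power_add[of ?p ?T] by (simp only: mult.assoc) simp
  have 4: "(- w) ^ (n + 1) * (- (inverse w * ?p)) ^ (n + 1) = ?p ^ (n + 1)"
    using w by (simp only: power_mult_distrib[symmetric]) (simp add: mult.assoc[symmetric])
  have 5: "qpoch w ?p (n + 1) * qpoch (inverse w * ?p) ?p (n + 1) =
    ?p ^ ?T * ?p ^ ?T * (?p ^ (n + 1) * (qpoch (inverse w) q (n + 1) * qpoch (w * q) q (n + 1)))"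
    unfolding 2 3 4[symmetric] by (simp only: mult_ac)
  \<comment> \<open>Here y is the quadratic power of 1/q, twice above and twice below, while s and r
    are the (n+1)-st powers of 1/q and q.\<close>
  have 6: "y * A * y / (y * y * (s * D)) = A * r / D" if "y \<noteq> 0" "s * r = 1" for y A s r D :: complex
  proof -
    have "r = inverse s" using that(2) by (metis inverse_unique)
    have "y * A * y / (y * y * (s * D)) = (y * y) * A / ((y * y) * (s * D))" by (simp only: mult_ac)
    also have "\<dots> = A / (s * D)" using that(1) by simp
    finally show ?thesis unfolding \<open>r = inverse s\<close> by (simp add: divide_inverse)
  qed
  show "qpoch (- ?p) ?p n * ?p ^ ?T / (qpoch w ?p (n + 1) * qpoch (inverse w * ?p) ?p (n + 1))
      = term21 w n"
    unfolding 1 5 term21_def Suc_eq_plus1 by (intro 6 inverse_q_power) (use q_nonzero in simp)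
qed

lemma g22_eq:
  assumes w: "generic w"
  shows "g22 w (inverse q) = inverse w * (\<Sum>n. term22 (inverse w) n) - inverse w / 2"
proof -
  define x where "x = inverse w"
  have x: "generic x" "x \<noteq> 0" using w generic_inverse generic_nonzero by (auto simp: x_def)
  have w': "w = inverse x" by (simp add: x_def)
  have x1: "x \<noteq> 1" using generic_mult_power_ne_1[OF x(1), of 0] by simp
  have "O2 w (inverse q) = (\<Sum>n. qpoch (- 1) q n * q ^ n / (qpoch (x * q) q n * qpoch (inverse x * q) q n))"
    unfolding O2_def tri_def[symmetric]
  proof (intro suminf_cong)
    fix n :: nat
    let ?p = "inverse q" and ?T = "tri n"
    have 1: "qpoch (- 1) ?p n = ?p ^ ?T * q ^ n * qpoch (- 1) q n"
      using qpoch_inverse_base[of "- 1" q n] q_nonzero by simp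
    have 2: "qpoch (w * ?p) ?p n = (- (w * ?p)) ^ n * ?p ^ ?T * q ^ n * qpoch (x * q) q n"
      using qpoch_inverse_base[of "w * ?p" q n] q_nonzero x by (simp add: w')
    have 3: "qpoch (inverse w * ?p) ?p n = (- (inverse w * ?p)) ^ n * ?p ^ ?T * q ^ n * qpoch (inverse x * q) q n"
      using qpoch_inverse_base[of "inverse w * ?p" q n] q_nonzero x by (simp add: w')
    \<comment> \<open>The monomials in w and 1/w cancel completely, including all linear powers of q
      from the denominator.\<close>
    have 4: "(- (w * ?p)) ^ n * (- (inverse w * ?p)) ^ n * q ^ n * q ^ n = 1"
      using x q_nonzero by (simp only: power_mult_distrib[symmetric]) (simp add: w' field_simps)
    have "qpoch (w * ?p) ?p n * qpoch (inverse w * ?p) ?p n = (- (w * ?p)) ^ n * (- (inverse w * ?p)) ^ n * q ^ n * q ^ n *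
      (?p ^ ?T * ?p ^ ?T * (qpoch (x * q) q n * qpoch (inverse x * q) q n))"
      unfolding 2 3 by (simp only: mult_ac)
    then have "qpoch (w * ?p) ?p n * qpoch (inverse w * ?p) ?p n =
        ?p ^ ?T * ?p ^ ?T * (qpoch (x * q) q n * qpoch (inverse x * q) q n)"
      unfolding 4 by simp
    then show "qpoch (- 1) ?p n * ?p ^ ?T / (qpoch (w * ?p) ?p n * qpoch (inverse w * ?p) ?p n)
      = qpoch (- 1) q n * q ^ n / (qpoch (x * q) q n * qpoch (inverse x * q) q n)"
      unfolding 1 using q_nonzero by (simp add: field_simps)
  qed
  moreover have "(\<Sum>n. term22 x n) = - (1 + x) / (2 * (1 - x)) *
      (\<Sum>n. qpoch (- 1) q n * q ^ n / (qpoch (x * q) q n * qpoch (inverse x * q) q n))"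
    using summable_term22[OF x(1)] unfolding term22_def by (rule suminf_mult_left)
  ultimately have A: "(\<Sum>n. term22 x n) = - (1 + x) / (2 * (1 - x)) * O2 w (inverse q)" by simp
  have B: "(1 + w) / (2 * w * (1 - w)) = x * (- (1 + x) / (2 * (1 - x)))"
    unfolding w' using x(2) x1 by (simp add: divide_simps) (simp add: algebra_simps)
  have C: "1 / (2 * w) = x / 2" unfolding w' using x(2) by (simp add: field_simps)
  show ?thesis unfolding g22_def x_def[symmetric] A B C by (simp only: mult.assoc)
qed

lemma g23_eq:
  assumes w: "norm w > 1"
  shows "g23 w (inverse q) = - (inverse w / 2) * (\<Sum>n. term23 (inverse w) n) - inverse w / 2"
proof -
  define x where "x = inverse w"
  have x: "norm x < 1" "x \<noteq> 0" using w by (auto simp: x_def norm_inverse inverse_less_1_iff)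
  have w': "w = inverse x" by (simp add: x_def)
  have t: "qpoch (- w * inverse q) (inverse q) n / qpoch (w * inverse q) (inverse q) n * w powi (- int n)
      = qpoch (- x * q) q n / qpoch (x * q) q n * (- x) ^ n" for n
  proof -
    let ?p = "inverse q" and ?T = "tri n"
    have 1: "qpoch (- w * ?p) ?p n = (w * ?p) ^ n * ?p ^ ?T * q ^ n * qpoch (- x * q) q n"
      using qpoch_inverse_base[of "- w * ?p" q n] q_nonzero x by (simp add: w')
    have 2: "qpoch (w * ?p) ?p n = (- 1) ^ n * (w * ?p) ^ n * ?p ^ ?T * q ^ n * qpoch (x * q) q n"
      using qpoch_inverse_base[of "w * ?p" q n] q_nonzero x
      by (simp add: w') (intro disjI2 power_minus)
    have 3: "w powi (- int n) = x ^ n" by (simp add: w' power_int_minus flip: power_inverse)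
    \<comment> \<open>For e = (-1)^n, which is its own inverse, the sign moves from the denominator
      into (-x)^n.\<close>
    have 4: "y * P / (e * y * D) * z = P / D * (e * z)" if "y \<noteq> 0" "e * e = 1" for y P e D z :: complex
    proof -
      have "inverse e = e" using that(2) by (rule inverse_unique)
      then show ?thesis using that(1) by (simp add: divide_inverse)
    qed
    have "(w * ?p) ^ n * ?p ^ ?T * q ^ n \<noteq> 0" using x q_nonzero by (simp add: w')
    from 4[OF this, of "(- 1) ^ n" "qpoch (- x * q) q n" "qpoch (x * q) q n" "x ^ n"]
    show ?thesis unfolding 1 2 3 power_minus[of x] by (simp only: mult.assoc) (simp flip: power_mult_distrib)
  qed
  have A: "(\<Sum>n. term23 x n) = (1 + x) *
      (\<Sum>n. qpoch (- w * inverse q) (inverse q) n / qpoch (w * inverse q) (inverse q) n * w powi (- int n))"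
    using summable_term23[OF x(1)] unfolding term23_def t by (rule suminf_mult_left)
  have B: "(1 + w) / (2 * w\<^sup>2) = x / 2 * (1 + x)"
    unfolding w' using x(2) by (simp add: divide_simps power2_eq_square)
  have C: "1 / (2 * w) = x / 2" unfolding w' using x(2) by (simp add: field_simps)
  show ?thesis unfolding g23_def x_def[symmetric] A B C by (simp only: mult.assoc mult_minus_left)
qed

end

theorem theorem4p2:
  fixes q :: complex
  assumes "0 < norm q" and "norm q < 1"
  shows "(\<forall>w::complex. w \<noteq> 0 \<and> (\<forall>l::int. w \<noteq> q powi l) \<longrightarrow>
            g21 w (inverse q) = - (w powi (-2)) * \<psi>3 w q - inverse w + S4 w q \<and>
            g22 w (inverse q) = \<psi>3 (inverse w) q + S1 (- inverse w) q) \<and>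
         (\<forall>w::complex. norm w > 1 \<and> (\<forall>l::nat. l \<ge> 1 \<longrightarrow> w \<noteq> q ^ l) \<longrightarrow>
            g23 w (inverse q) = \<psi>3 (inverse w) q)"
proof -
  interpret nome q using assms by unfold_locales
  show ?thesis
  proof (intro conjI allI impI)
    fix w :: complex
    assume "w \<noteq> 0 \<and> (\<forall>l::int. w \<noteq> q powi l)"
    then have w: "generic w" "w \<noteq> 0" by (simp_all add: generic_def)
    show "g21 w (inverse q) = - (w powi (-2)) * \<psi>3 w q - inverse w + S4 w q"
    proof -
      have "S4 w q = qpoch_inf (- q) q / theta_denom w * \<psi>4 w q"
        by (simp add: S4_def theta_denom_def)
      moreover have "- (w powi (-2)) * \<psi>3 w q = inverse w * suminf (ptheta w)"
        using w(2) by (simp add: psi3_eq power_int_def power2_eq_square)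
      ultimately show ?thesis
        by (simp add: g21_eq[OF w(2)] suminf_term21_eq[OF w(1)] right_diff_distrib)
    qed
    \<comment> \<open>The constant 1/2 from the initial theta term cancels the summand -1/(2w) of
      \<open>g22\<close>.\<close>
    show "g22 w (inverse q) = \<psi>3 (inverse w) q + S1 (- inverse w) q"
      using w by (simp add: g22_eq suminf_term22_eq generic_inverse S1_minus_eq psi3_eq algebra_simps)
  next
    fix w :: complex
    assume "norm w > 1 \<and> (\<forall>l::nat. l \<ge> 1 \<longrightarrow> w \<noteq> q ^ l)"
    then have w: "norm w > 1" by simp
    then have "norm (inverse w) < 1" by (simp add: norm_inverse inverse_less_1_iff)
    \<comment> \<open>The -1 in 2 \<open>suminf (ptheta x)\<close> - 1 likewise cancels the summand
      -1/(2w) of \<open>g23\<close>.\<close>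
    then show "g23 w (inverse q) = \<psi>3 (inverse w) q"
      by (simp add: g23_eq[OF w] suminf_term23_eq psi3_eq right_diff_distrib)
  qed
qed

end
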